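(* Let $\mathbb G=(\mathbb V,\mathbb E)$ be a countably infinite, locally finite, connected graph with edge weights $\mathbf c_e\ge1$. For $x\in\mathbb V$ and finite connected subgraphs $D\subset D'$ of $\mathbb G$ containing $x$, one has $\mathbb E^{\pm1}_D[h(x)^2]\le\mathbb E^{\pm1}_{D'}[h(x)^2]$. Consequently, as $D\uparrow\mathbb G$, either $\mathbb E^{\pm1}_D[h(x)^2]$ increases to a finite limit (Var-loc) or it increases to $+\infty$ (Var-deloc); moreover the same alternative occurs for all $x\in\mathbb V$.
   Context: $\mathbb Z_{\rm odd}=2\mathbb Z+1$. For a finite connected subgraph $D=(V,E)$ of $\mathbb G$, a height function is $h:V\to\mathbb Z_{\rm odd}$ with $|h(v)-h(w)|\le2$ along edges of $D$, weight $W(h)=\prod_{e=\langle v,w\rangle\in E}\mathbf c_e^{\mathbb 1\{h(v)=h(w)\}}$; $\partial D$ is the set of vertices of $D$ incident to an edge of $\mathbb E\setminus E$; $\mathbb P^{\pm1}_D$ is the probability measure on height functions on $D$ with $h(x)\in\{-1,1\}$ for $x\in\partial D$ and probabilities proportional to $W(h)$. *)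

theory Defs
  imports "HOL-Analysis.Analysis"
begin

text \<open>The ambient graph has vertex set UNIV :: 'v set and a symmetric,
irreflexive adjacency relation E.  Edges are unordered pairs {v,w}.
A subgraph D is a pair (V, ED) of a vertex set and a set of edges.\<close>

definition Gedges :: "('v \<Rightarrow> 'v \<Rightarrow> bool) \<Rightarrow> 'v set set" where
  "Gedges E = {{v, w} | v w. E v w}"

definition fin_conn_subgraph :: "('v \<Rightarrow> 'v \<Rightarrow> bool) \<Rightarrow> 'v set \<times> 'v set set \<Rightarrow> bool" where
  "fin_conn_subgraph E D \<longleftrightarrow>
     finite (fst D) \<and> fst D \<noteq> {} \<and> snd D \<subseteq> Gedges E \<and> (\<forall>e\<in>snd D. e \<subseteq> fst D) \<and>
     (\<forall>x\<in>fst D. \<forall>y\<in>fst D. (\<lambda>a b. {a, b} \<in> snd D)\<^sup>*\<^sup>* x y)"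

definition subgraph_le :: "'v set \<times> 'v set set \<Rightarrow> 'v set \<times> 'v set set \<Rightarrow> bool" where
  "subgraph_le D D' \<longleftrightarrow> fst D \<subseteq> fst D' \<and> snd D \<subseteq> snd D'"

definition bdry :: "('v \<Rightarrow> 'v \<Rightarrow> bool) \<Rightarrow> 'v set \<times> 'v set set \<Rightarrow> 'v set" where
  "bdry E D = {v \<in> fst D. \<exists>w. E v w \<and> {v, w} \<notin> snd D}"

definition height_funs :: "('v \<Rightarrow> 'v \<Rightarrow> bool) \<Rightarrow> 'v set \<times> 'v set set \<Rightarrow> ('v \<Rightarrow> int) set" where
  "height_funs E D = {h. (\<forall>v. v \<notin> fst D \<longrightarrow> h v = 0) \<and> (\<forall>v\<in>fst D. odd (h v)) \<and>
      (\<forall>v w. {v, w} \<in> snd D \<longrightarrow> \<bar>h v - h w\<bar> \<le> 2) \<and>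
      (\<forall>v\<in>bdry E D. h v \<in> {-1, 1})}"

definition hweight :: "('v set \<Rightarrow> real) \<Rightarrow> 'v set \<times> 'v set set \<Rightarrow> ('v \<Rightarrow> int) \<Rightarrow> real" where
  "hweight c D h = (\<Prod>e\<in>snd D. c e ^ (if (\<exists>v w. e = {v, w} \<and> h v = h w) then 1 else 0))"

definition Eh2 :: "('v \<Rightarrow> 'v \<Rightarrow> bool) \<Rightarrow> ('v set \<Rightarrow> real) \<Rightarrow> 'v set \<times> 'v set set \<Rightarrow> 'v \<Rightarrow> real" where
  "Eh2 E c D x = (\<Sum>h\<in>height_funs E D. hweight c D h * (real_of_int (h x))\<^sup>2) /
                 (\<Sum>h\<in>height_funs E D. hweight c D h)"

definition exhaustion :: "('v \<Rightarrow> 'v \<Rightarrow> bool) \<Rightarrow> (nat \<Rightarrow> 'v set \<times> 'v set set) \<Rightarrow> bool" where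
  "exhaustion E Ds \<longleftrightarrow> (\<forall>n. fin_conn_subgraph E (Ds n)) \<and> (\<forall>n. subgraph_le (Ds n) (Ds (Suc n))) \<and>
     (\<Union>n. fst (Ds n)) = UNIV \<and> (\<Union>n. snd (Ds n)) = Gedges E"

end

theory Submission
  imports Defs
begin

text \<open>
  Write a height function as \<open>h = k \<sigma>\<close> with \<open>k = \<bar>h\<bar>\<close> and \<open>\<sigma>\<close> its sign. Summing over \<open>\<sigma>\<close> gives the
  weight \<open>Z k\<close> of \<open>k\<close> as the partition function of a ferromagnetic Ising model, because \<open>c \<ge> 1\<close>.
  For \<open>D \<subseteq> D'\<close> extend the model on \<open>D\<close> to the vertices of \<open>D'\<close> by free spins with \<open>k = 1\<close> outside
  \<open>D\<close>. Griffiths' duplication trick \<open>\<sigma>' = \<sigma> \<tau>\<close> then reduces Holley's condition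
  \<open>Z\<^sub>D k * Z\<^sub>D\<^sub>' k' \<le> Z\<^sub>D (min k k') * Z\<^sub>D\<^sub>' (max k k')\<close> to an inequality for a single edge, and
  the four functions theorem on the product of chains yields the monotonicity of the second moment
  of \<open>k x\<close>. For the dichotomy, heights at adjacent vertices differ by at most \<open>2\<close>, so boundedness of
  the second moments spreads along edges, and any finite subgraph is eventually contained in every
  exhaustion.
\<close>

section \<open>The four functions theorem on a product of chains\<close>

text \<open>Expanding \<open>0 \<le> (X - A) * (X - B)\<close> gives
  \<open>X * (A + B) \<le> X * X + A * B \<le> X * (X + Y)\<close>, and \<open>X\<close> cancels. If
  \<open>X = 0\<close>, then \<open>A\<close> and \<open>B\<close> vanish as well.\<close>

lemma four_functions_two_points:
  fixes A B X Y :: real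
  assumes "A \<le> X" "B \<le> X" "A * B \<le> X * Y" "0 \<le> A" "0 \<le> B" "0 \<le> Y"
  shows "A + B \<le> X + Y"
proof (cases "X = 0")
  case True
  then show ?thesis using assms by simp
next
  case False
  then have "X > 0" using assms by linarith
  have "0 \<le> (X - A) * (X - B)" using assms by simp
  then have "X * (A + B) \<le> X * (X + Y)"
    using assms(3) by (simp add: algebra_simps)
  then show ?thesis using \<open>X > 0\<close> by simp
qed

text \<open>Pair the term \<open>(s, t)\<close> of the expanded products with \<open>(t, s)\<close>.
  For \<open>s \<le> t\<close> both terms on the left are at most
  \<open>\<gamma> s * \<delta> t\<close>, and the diagonal hypotheses bound their product, so the
  two-point inequality applies with \<open>Y = \<gamma> t * \<delta> s\<close>.\<close>

lemma four_functions_chain: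
  fixes C :: "'a::linorder set" and \<alpha> \<beta> \<gamma> \<delta> :: "'a \<Rightarrow> real"
  assumes nonneg: "\<And>s. s \<in> C \<Longrightarrow> 0 \<le> \<alpha> s \<and> 0 \<le> \<beta> s \<and> 0 \<le> \<gamma> s \<and> 0 \<le> \<delta> s"
    and le: "\<And>s t. s \<in> C \<Longrightarrow> t \<in> C \<Longrightarrow> \<alpha> s * \<beta> t \<le> \<gamma> (min s t) * \<delta> (max s t)"
  shows "sum \<alpha> C * sum \<beta> C \<le> sum \<gamma> C * sum \<delta> C"
proof -
  have ordered: "\<alpha> s * \<beta> t + \<alpha> t * \<beta> s \<le> \<gamma> s * \<delta> t + \<gamma> t * \<delta> s"
    if st: "s \<in> C" "t \<in> C" "s \<le> t" for s t
  proof (rule four_functions_two_points)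
    show "\<alpha> s * \<beta> t \<le> \<gamma> s * \<delta> t" "\<alpha> t * \<beta> s \<le> \<gamma> s * \<delta> t"
      using le[of s t] le[of t s] st by (simp_all add: min_def max_def split: if_splits)
    have "(\<alpha> s * \<beta> s) * (\<alpha> t * \<beta> t) \<le> (\<gamma> s * \<delta> s) * (\<gamma> t * \<delta> t)"
      using le[of s s] le[of t t] nonneg st by (intro mult_mono[of "\<alpha> s * \<beta> s"]) auto
    then show "\<alpha> s * \<beta> t * (\<alpha> t * \<beta> s) \<le> \<gamma> s * \<delta> t * (\<gamma> t * \<delta> s)"
      by (simp add: mult_ac)
  qed (use nonneg st in auto)
  have pair: "\<alpha> s * \<beta> t + \<alpha> t * \<beta> s \<le> \<gamma> s * \<delta> t + \<gamma> t * \<delta> s" if "s \<in> C" "t \<in> C" for s t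
    using ordered[of s t] ordered[of t s] that linear[of s t] by linarith
  have twice: "(\<Sum>s\<in>C. \<Sum>t\<in>C. f s * g t + f t * g s) = 2 * (sum f C * sum g C)"
    for f g :: "'a \<Rightarrow> real"
  proof -
    have "(\<Sum>s\<in>C. \<Sum>t\<in>C. f t * g s) = (\<Sum>s\<in>C. \<Sum>t\<in>C. f s * g t)"
      by (rule sum.swap)
    then show ?thesis by (simp add: sum.distrib sum_product)
  qed
  have "2 * (sum \<alpha> C * sum \<beta> C) \<le> 2 * (sum \<gamma> C * sum \<delta> C)"
    unfolding twice[symmetric] by (intro sum_mono pair)
  then show ?thesis by simp
qed

lemma sum_PiE_insert:
  assumes "i \<notin> I"
  shows "sum \<phi> (PiE (insert i I) C) = (\<Sum>f\<in>PiE I C. \<Sum>s\<in>C i. \<phi> (f(i := s)))"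
proof -
  have "sum \<phi> (PiE (insert i I) C) = (\<Sum>(s, f)\<in>C i \<times> PiE I C. \<phi> (f(i := s)))"
    unfolding PiE_insert_eq
    by (subst sum.reindex[OF inj_combinator[OF assms]]) (simp add: case_prod_unfold)
  also have "\<dots> = (\<Sum>s\<in>C i. \<Sum>f\<in>PiE I C. \<phi> (f(i := s)))"
    by (simp add: sum.cartesian_product)
  also have "\<dots> = (\<Sum>f\<in>PiE I C. \<Sum>s\<in>C i. \<phi> (f(i := s)))"
    by (rule sum.swap)
  finally show ?thesis .
qed

text \<open>The pointwise minimum and maximum of two functions of \<^term>\<open>PiE I C\<close> lie in
  \<^term>\<open>PiE I C\<close> again: outside \<^term>\<open>I\<close> both functions equal \<^const>\<open>undefined\<close>.\<close>

theorem four_functions_PiE: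
  fixes C :: "'i \<Rightarrow> 'a::linorder set" and \<alpha> \<beta> \<gamma> \<delta> :: "('i \<Rightarrow> 'a) \<Rightarrow> real"
  assumes "finite I"
    and "\<And>f. f \<in> PiE I C \<Longrightarrow> 0 \<le> \<alpha> f \<and> 0 \<le> \<beta> f \<and> 0 \<le> \<gamma> f \<and> 0 \<le> \<delta> f"
    and "\<And>f g. f \<in> PiE I C \<Longrightarrow> g \<in> PiE I C \<Longrightarrow>
           \<alpha> f * \<beta> g \<le> \<gamma> (\<lambda>i. min (f i) (g i)) * \<delta> (\<lambda>i. max (f i) (g i))"
  shows "sum \<alpha> (PiE I C) * sum \<beta> (PiE I C) \<le> sum \<gamma> (PiE I C) * sum \<delta> (PiE I C)"
  using assms
proof (induction I arbitrary: \<alpha> \<beta> \<gamma> \<delta> rule: finite_induct)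
  case empty
  from empty(2)[of "\<lambda>_. undefined" "\<lambda>_. undefined"] show ?case by simp
next
  case (insert i I)
  have upd: "f(i := s) \<in> PiE (insert i I) C" if "f \<in> PiE I C" "s \<in> C i" for f s
    using that by (rule PiE_fun_upd[rotated])
  have minmax: "(\<lambda>i. min (f i) (g i)) \<in> PiE I C" "(\<lambda>i. max (f i) (g i)) \<in> PiE I C"
    if "f \<in> PiE I C" "g \<in> PiE I C" for f g
    using that by (auto simp: PiE_iff min_def max_def extensional_def)
  show ?case
    unfolding sum_PiE_insert[OF insert.hyps(2)]
  \<comment> \<open>The induction hypothesis is applied to the marginals obtained by summing out
    coordinate \<open>i\<close>. Their lattice condition is the chain case in that coordinate, with
    \<open>f\<close> and \<open>g\<close> fixed.\<close>
  proof (rule insert.IH)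
    fix f assume "f \<in> PiE I C"
    then show "0 \<le> (\<Sum>s\<in>C i. \<alpha> (f(i := s))) \<and> 0 \<le> (\<Sum>s\<in>C i. \<beta> (f(i := s))) \<and>
       0 \<le> (\<Sum>s\<in>C i. \<gamma> (f(i := s))) \<and> 0 \<le> (\<Sum>s\<in>C i. \<delta> (f(i := s)))"
      using insert.prems(1)[OF upd] by (intro conjI sum_nonneg) blast+
  next
    fix f g assume fg: "f \<in> PiE I C" "g \<in> PiE I C"
    show "(\<Sum>s\<in>C i. \<alpha> (f(i := s))) * (\<Sum>s\<in>C i. \<beta> (g(i := s)))
       \<le> (\<Sum>s\<in>C i. \<gamma> ((\<lambda>j. min (f j) (g j))(i := s))) *
          (\<Sum>s\<in>C i. \<delta> ((\<lambda>j. max (f j) (g j))(i := s)))"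
    proof (rule four_functions_chain)
      fix s assume "s \<in> C i"
      then show "0 \<le> \<alpha> (f(i := s)) \<and> 0 \<le> \<beta> (g(i := s)) \<and>
        0 \<le> \<gamma> ((\<lambda>j. min (f j) (g j))(i := s)) \<and> 0 \<le> \<delta> ((\<lambda>j. max (f j) (g j))(i := s))"
        using insert.prems(1)[OF upd[OF fg(1)]] insert.prems(1)[OF upd[OF fg(2)]]
          insert.prems(1)[OF upd[OF minmax(1)[OF fg]]] insert.prems(1)[OF upd[OF minmax(2)[OF fg]]]
        by blast
    next
      fix s t assume st: "s \<in> C i" "t \<in> C i"
      have "(\<lambda>j. min ((f(i := s)) j) ((g(i := t)) j)) = (\<lambda>j. min (f j) (g j))(i := min s t)"
        "(\<lambda>j. max ((f(i := s)) j) ((g(i := t)) j)) = (\<lambda>j. max (f j) (g j))(i := max s t)"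
        by auto
      with insert.prems(2)[OF upd upd, OF fg(1) st(1) fg(2) st(2)]
      show "\<alpha> (f(i := s)) * \<beta> (g(i := t))
        \<le> \<gamma> ((\<lambda>j. min (f j) (g j))(i := min s t)) * \<delta> ((\<lambda>j. max (f j) (g j))(i := max s t))"
        by (simp only:)
    qed
  qed
qed

section \<open>Griffiths inequalities by duplication\<close>

abbreviation spins :: "'v set \<Rightarrow> ('v \<Rightarrow> int) set" where
  "spins V \<equiv> V \<rightarrow>\<^sub>E {-1, 1}"

text \<open>Every function of a sign \<open>s\<close> has the form \<open>p + q * s\<close>, as in
  \<open>exp (J * s) = cosh J + s * sinh J\<close>; the ferromagnetic case is
  \<open>0 \<le> q \<le> p\<close>. Free coefficients instead of couplings \<open>J\<close> allow
  hard constraints and the signed coefficients produced by duplication.\<close>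

definition ising_Z :: "'v set \<Rightarrow> 'v set set \<Rightarrow> ('v set \<Rightarrow> real) \<Rightarrow> ('v set \<Rightarrow> real) \<Rightarrow> real" where
  "ising_Z V F p q = (\<Sum>\<sigma>\<in>spins V. \<Prod>e\<in>F. p e + q e * of_int (\<Prod>v\<in>e. \<sigma> v))"

lemma spin_square: "\<sigma> \<in> spins V \<Longrightarrow> v \<in> V \<Longrightarrow> \<sigma> v * \<sigma> v = 1"
  by (force simp: PiE_iff)

lemma spin_prod_square:
  assumes "\<sigma> \<in> spins V" "e \<subseteq> V"
  shows "(\<Prod>v\<in>e. \<sigma> v) * (\<Prod>v\<in>e. \<sigma> v) = 1"
  using assms by (simp add: prod.distrib[symmetric] spin_square subset_iff)

lemma spin_prod_cases:
  assumes "\<sigma> \<in> spins V" "e \<subseteq> V"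
  shows "(\<Prod>v\<in>e. \<sigma> v) \<in> {-1, 1}"
  using spin_prod_square[OF assms] by (metis insert_iff square_eq_1_iff)

text \<open>The sum factorises over the vertices; each factor is \<open>2\<close> or
  \<open>0\<close> according to the parity of the exponent.\<close>

lemma sum_spin_monomial_nonneg:
  assumes "finite V"
  shows "0 \<le> (\<Sum>\<sigma>\<in>spins V. real_of_int (\<Prod>v\<in>V. \<sigma> v ^ n v))"
proof -
  have "(\<Sum>\<sigma>\<in>spins V. (\<Prod>v\<in>V. \<sigma> v ^ n v)) = (\<Prod>v\<in>V. \<Sum>s\<in>{-1, 1}. s ^ n v)"
    using assms by (subst prod_sum_PiE) auto
  also have "\<dots> \<ge> 0"
  proof (rule prod_nonneg)
    fix v assume "v \<in> V"
    show "0 \<le> (\<Sum>s\<in>{-1, 1::int}. s ^ n v)" by (cases "even (n v)") auto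
  qed
  finally show ?thesis unfolding of_int_sum[symmetric] of_int_0_le_iff .
qed

text \<open>The exponents \<^term>\<open>n\<close> make the induction over the edges go through.\<close>

lemma ising_sum_mono:
  fixes p q P Q :: "'v set \<Rightarrow> real"
  assumes "finite F" "finite V" "\<And>e. e \<in> F \<Longrightarrow> e \<subseteq> V"
    and "\<And>e. e \<in> F \<Longrightarrow> \<bar>p e\<bar> \<le> P e" "\<And>e. e \<in> F \<Longrightarrow> \<bar>q e\<bar> \<le> Q e"
  shows "\<bar>\<Sum>\<sigma>\<in>spins V. of_int (\<Prod>v\<in>V. \<sigma> v ^ n v) * (\<Prod>e\<in>F. p e + q e * of_int (\<Prod>v\<in>e. \<sigma> v))\<bar>
    \<le> (\<Sum>\<sigma>\<in>spins V. of_int (\<Prod>v\<in>V. \<sigma> v ^ n v) * (\<Prod>e\<in>F. P e + Q e * of_int (\<Prod>v\<in>e. \<sigma> v)))"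
  using assms(1) assms(3-)
proof (induction F arbitrary: n rule: finite_induct)
  case empty
  show ?case using sum_spin_monomial_nonneg[OF \<open>finite V\<close>, of n] by simp
next
  case (insert e F)
  define S where "S p q n = (\<Sum>\<sigma>\<in>spins V. of_int (\<Prod>v\<in>V. \<sigma> v ^ n v) *
     (\<Prod>e\<in>F. p e + q e * of_int (\<Prod>v\<in>e. \<sigma> v)))" for p q :: "'v set \<Rightarrow> real" and n :: "'v \<Rightarrow> nat"
  \<comment> \<open>Taking the \<open>q\<close>-term of the factor of \<open>e\<close> multiplies
    the monomial by the spins of \<open>e\<close>, which raises the exponents on \<open>e\<close> by
    one.\<close>
  define m where "m v = n v + (if v \<in> e then 1 else 0)" for v
  have IH: "\<bar>S p q n\<bar> \<le> S P Q n" for n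
    unfolding S_def by (rule insert.IH) (use insert.prems in auto)
  have monomial: "(\<Prod>v\<in>V. \<sigma> v ^ m v) = (\<Prod>v\<in>V. \<sigma> v ^ n v) * (\<Prod>v\<in>e. \<sigma> v)" for \<sigma> :: "'v \<Rightarrow> int"
  proof -
    have "(\<Prod>v\<in>V. \<sigma> v ^ m v) = (\<Prod>v\<in>V. \<sigma> v ^ n v) * (\<Prod>v\<in>V. if v \<in> e then \<sigma> v else 1)"
      unfolding prod.distrib[symmetric] m_def by (intro prod.cong) auto
    also have "(\<Prod>v\<in>V. if v \<in> e then \<sigma> v else 1) = (\<Prod>v\<in>e. \<sigma> v)"
      using insert.prems(1)[of e] \<open>finite V\<close> by (simp flip: prod.inter_restrict add: Int_absorb1)
    finally show ?thesis .
  qed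
  have step: "(\<Sum>\<sigma>\<in>spins V. of_int (\<Prod>v\<in>V. \<sigma> v ^ n v) *
      (\<Prod>e\<in>insert e F. p e + q e * of_int (\<Prod>v\<in>e. \<sigma> v))) = p e * S p q n + q e * S p q m"
    for p q :: "'v set \<Rightarrow> real"
    unfolding S_def sum_distrib_left sum.distrib[symmetric] monomial
    using insert.hyps by (intro sum.cong) (simp_all add: algebra_simps)
  have "\<bar>p e * S p q n + q e * S p q m\<bar> \<le> \<bar>p e\<bar> * \<bar>S p q n\<bar> + \<bar>q e\<bar> * \<bar>S p q m\<bar>"
    using abs_triangle_ineq by (metis abs_mult)
  also have "\<dots> \<le> P e * S P Q n + Q e * S P Q m"
    using insert.prems(2,3)[of e] IH[of n] IH[of m] by (intro add_mono mult_mono) auto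
  finally show ?case unfolding step .
qed

lemma ising_Z_mono:
  assumes "finite F" "finite V" "\<And>e. e \<in> F \<Longrightarrow> e \<subseteq> V"
    and "\<And>e. e \<in> F \<Longrightarrow> \<bar>p e\<bar> \<le> P e" "\<And>e. e \<in> F \<Longrightarrow> \<bar>q e\<bar> \<le> Q e"
  shows "\<bar>ising_Z V F p q\<bar> \<le> ising_Z V F P Q"
  using ising_sum_mono[OF assms, where n = "\<lambda>_. 0"] by (simp add: ising_Z_def)

text \<open>Substituting \<open>\<sigma>' = \<sigma> \<tau>\<close> in the second factor turns the product into a sum over \<open>\<tau>\<close>
  of Ising partition functions in \<open>\<sigma>\<close>.\<close>

lemma ising_Z_mult:
  assumes "\<And>e. e \<in> F \<Longrightarrow> e \<subseteq> V"
  shows "ising_Z V F a b * ising_Z V F a' b' =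
    (\<Sum>\<tau>\<in>spins V. ising_Z V F (\<lambda>e. a e * a' e + b e * b' e * of_int (\<Prod>v\<in>e. \<tau> v))
                              (\<lambda>e. b e * a' e + a e * b' e * of_int (\<Prod>v\<in>e. \<tau> v)))"
proof -
  \<comment> \<open>The product is restricted to \<open>V\<close> so that it is
    \<open>undefined\<close> elsewhere and stays in \<open>spins V\<close>. Since spins square to
    one, \<open>T \<sigma>\<close> is an involution, hence a bijection of
    \<open>spins V\<close>.\<close>
  define T where "T \<sigma> \<tau> = (\<lambda>v\<in>V. \<sigma> v * \<tau> v)" for \<sigma> \<tau> :: "'a \<Rightarrow> int"
  have T_spin: "T \<sigma> \<tau> \<in> spins V" if "\<sigma> \<in> spins V" "\<tau> \<in> spins V" for \<sigma> \<tau>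
  proof (rule PiE_I)
    fix v assume "v \<in> V"
    then show "T \<sigma> \<tau> v \<in> {-1, 1}"
      using PiE_mem[OF that(1), of v] PiE_mem[OF that(2), of v] by (auto simp: T_def)
  qed (simp add: T_def)
  have T_invol: "T \<sigma> (T \<sigma> \<tau>) = \<tau>" if "\<sigma> \<in> spins V" "\<tau> \<in> spins V" for \<sigma> \<tau>
  proof
    fix v show "T \<sigma> (T \<sigma> \<tau>) v = \<tau> v"
    proof (cases "v \<in> V")
      case True
      then have "T \<sigma> (T \<sigma> \<tau>) v = (\<sigma> v * \<sigma> v) * \<tau> v"
        by (simp only: T_def restrict_apply' mult.assoc)
      then show ?thesis using spin_square[OF that(1) True] by simp
    next
      case False
      then show ?thesis using PiE_arb[OF that(2) False] by (simp add: T_def)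
    qed
  qed
  \<comment> \<open>The square of a spin product is one, so the product of the two factors is again
    affine in the spin product of \<sigma>, with coefficients depending on \<tau> only.\<close>
  have factor: "(a e + b e * of_int (\<Prod>v\<in>e. \<sigma> v)) * (a' e + b' e * of_int (\<Prod>v\<in>e. T \<sigma> \<tau> v)) =
     (a e * a' e + b e * b' e * of_int (\<Prod>v\<in>e. \<tau> v)) +
     (b e * a' e + a e * b' e * of_int (\<Prod>v\<in>e. \<tau> v)) * of_int (\<Prod>v\<in>e. \<sigma> v)"
    if "\<sigma> \<in> spins V" "e \<in> F" for \<sigma> \<tau> e
  proof -
    have eV: "e \<subseteq> V" using assms that by blast
    define s where "s = real_of_int (\<Prod>v\<in>e. \<sigma> v)"
    define t where "t = real_of_int (\<Prod>v\<in>e. \<tau> v)"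
    have "(\<Prod>v\<in>e. T \<sigma> \<tau> v) = (\<Prod>v\<in>e. \<sigma> v) * (\<Prod>v\<in>e. \<tau> v)"
      unfolding prod.distrib[symmetric] T_def using eV by (intro prod.cong) auto
    then have "real_of_int (\<Prod>v\<in>e. T \<sigma> \<tau> v) = s * t" by (simp add: s_def t_def)
    moreover have "s * s = 1"
      using spin_prod_square[OF that(1) eV] unfolding s_def by (metis of_int_1 of_int_mult)
    moreover have "(a e + b e * s) * (a' e + b' e * (s * t)) =
      a e * a' e + b e * b' e * (s * s) * t + (b e * a' e + a e * b' e * t) * s"
      by (simp add: algebra_simps)
    ultimately show ?thesis unfolding s_def[symmetric] t_def[symmetric] by simp
  qed
  have "ising_Z V F a b * ising_Z V F a' b' =
    (\<Sum>\<sigma>\<in>spins V. \<Sum>\<sigma>'\<in>spins V. \<Prod>e\<in>F. (a e + b e * of_int (\<Prod>v\<in>e. \<sigma> v)) *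
       (a' e + b' e * of_int (\<Prod>v\<in>e. \<sigma>' v)))"
    unfolding ising_Z_def sum_product prod.distrib ..
  also have "\<dots> = (\<Sum>\<sigma>\<in>spins V. \<Sum>\<tau>\<in>spins V. \<Prod>e\<in>F. (a e + b e * of_int (\<Prod>v\<in>e. \<sigma> v)) *
       (a' e + b' e * of_int (\<Prod>v\<in>e. T \<sigma> \<tau> v)))"
  proof (rule sum.cong[OF refl])
    fix \<sigma> assume "\<sigma> \<in> spins V"
    then have "bij_betw (T \<sigma>) (spins V) (spins V)"
      using T_spin T_invol by (intro bij_betw_byWitness[where f' = "T \<sigma>"] ballI image_subsetI)
    then show "(\<Sum>\<sigma>'\<in>spins V. \<Prod>e\<in>F. (a e + b e * of_int (\<Prod>v\<in>e. \<sigma> v)) * (a' e + b' e * of_int (\<Prod>v\<in>e. \<sigma>' v))) =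
      (\<Sum>\<tau>\<in>spins V. \<Prod>e\<in>F. (a e + b e * of_int (\<Prod>v\<in>e. \<sigma> v)) * (a' e + b' e * of_int (\<Prod>v\<in>e. T \<sigma> \<tau> v)))"
      by (rule sum.reindex_bij_betw[symmetric])
  qed
  also have "\<dots> = (\<Sum>\<sigma>\<in>spins V. \<Sum>\<tau>\<in>spins V. \<Prod>e\<in>F.
     (a e * a' e + b e * b' e * of_int (\<Prod>v\<in>e. \<tau> v)) +
     (b e * a' e + a e * b' e * of_int (\<Prod>v\<in>e. \<tau> v)) * of_int (\<Prod>v\<in>e. \<sigma> v))"
    by (intro sum.cong prod.cong factor refl)
  finally show ?thesis unfolding ising_Z_def by (subst (asm) sum.swap)
qed

text \<open>After duplication both sides are sums over \<tau>, compared term by term: for fixed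
  \<tau> each term is one partition function, monotone in its coefficients. The number
  \<open>t\<close> stands for the spin product of \<tau> over the edge.\<close>

lemma ising_Z_mult_mono:
  fixes a b a' b' A B A' B' :: "'v set \<Rightarrow> real"
  assumes "finite F" "finite V" and sub: "\<And>e. e \<in> F \<Longrightarrow> e \<subseteq> V"
    and P: "\<And>e t. e \<in> F \<Longrightarrow> t \<in> {-1, 1} \<Longrightarrow>
      \<bar>a e * a' e + b e * b' e * t\<bar> \<le> A e * A' e + B e * B' e * t"
    and Q: "\<And>e t. e \<in> F \<Longrightarrow> t \<in> {-1, 1} \<Longrightarrow>
      \<bar>b e * a' e + a e * b' e * t\<bar> \<le> B e * A' e + A e * B' e * t"
  shows "ising_Z V F a b * ising_Z V F a' b' \<le> ising_Z V F A B * ising_Z V F A' B'"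
proof -
  have t: "real_of_int (\<Prod>v\<in>e. \<tau> v) \<in> {-1, 1}" if "\<tau> \<in> spins V" "e \<in> F" for \<tau> e
    using spin_prod_cases[OF that(1) sub[OF that(2)]] by (auto simp del: of_int_prod)
  have mult: "ising_Z V F a b * ising_Z V F a' b' =
    (\<Sum>\<tau>\<in>spins V. ising_Z V F (\<lambda>e. a e * a' e + b e * b' e * of_int (\<Prod>v\<in>e. \<tau> v))
                              (\<lambda>e. b e * a' e + a e * b' e * of_int (\<Prod>v\<in>e. \<tau> v)))" for a b a' b'
    using sub by (rule ising_Z_mult)
  show ?thesis
    unfolding mult
  proof (rule sum_mono, rule abs_le_D1)
    fix \<tau> assume "\<tau> \<in> spins V"
    then show "\<bar>ising_Z V F (\<lambda>e. a e * a' e + b e * b' e * of_int (\<Prod>v\<in>e. \<tau> v))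
                   (\<lambda>e. b e * a' e + a e * b' e * of_int (\<Prod>v\<in>e. \<tau> v))\<bar>
      \<le> ising_Z V F (\<lambda>e. A e * A' e + B e * B' e * of_int (\<Prod>v\<in>e. \<tau> v))
          (\<lambda>e. B e * A' e + A e * B' e * of_int (\<Prod>v\<in>e. \<tau> v))"
      using assms(1,2) sub by (intro ising_Z_mono P Q t)
  qed
qed

section \<open>Absolute heights\<close>

text \<open>The constraint on neighbouring heights is encoded as weight zero, so sums may run over
  all height configurations.\<close>

definition edge_weight :: "real \<Rightarrow> int \<Rightarrow> int \<Rightarrow> real" where
  "edge_weight c i j = (if i = j then c else if \<bar>i - j\<bar> \<le> 2 then 1 else 0)"

text \<open>The parts of the edge weight that are even and odd under a flip of one sign. For fixed
  absolute heights they are the coefficients \<open>p\<close> and \<open>q\<close> of an Ising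
  factor.\<close>

definition even_part :: "real \<Rightarrow> int \<Rightarrow> int \<Rightarrow> real" where
  "even_part c i j = (edge_weight c i j + edge_weight c i (- j)) / 2"

definition odd_part :: "real \<Rightarrow> int \<Rightarrow> int \<Rightarrow> real" where
  "odd_part c i j = (edge_weight c i j - edge_weight c i (- j)) / 2"

lemma edge_weight_commute: "edge_weight c i j = edge_weight c j i"
  by (auto simp: edge_weight_def abs_minus_commute)

lemma edge_weight_uminus: "edge_weight c (- i) j = edge_weight c i (- j)"
  by (auto simp: edge_weight_def)

lemma even_part_commute: "even_part c i j = even_part c j i"
  by (metis even_part_def edge_weight_commute edge_weight_uminus)

lemma odd_part_commute: "odd_part c i j = odd_part c j i"
  by (metis odd_part_def edge_weight_commute edge_weight_uminus)

text \<open>Flipping both signs leaves the edge weight unchanged, so only the relative sign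
  \<open>s * t\<close> matters.\<close>

lemma edge_weight_spin:
  assumes "s \<in> {-1, 1}" "t \<in> {-1, 1}"
  shows "edge_weight c (i * s) (j * t) = even_part c i j + odd_part c i j * of_int (s * t)"
  using assms by (auto simp: even_part_def odd_part_def edge_weight_uminus field_simps)

text \<open>Neighbouring heights can have opposite signs only if both have absolute value one, since
  otherwise \<open>i + j \<ge> 4\<close>. For every other admissible pair the edge forces equal
  signs, and the odd and even parts agree.\<close>

lemma even_part_pos_odd:
  assumes "odd i" "odd j" "0 < i" "0 < j"
  shows "even_part c i j = (if i = 1 \<and> j = 1 then (c + 1) / 2 else if i = j then c / 2
           else if \<bar>i - j\<bar> = 2 then 1 / 2 else 0)"
proof -
  have "i = j \<or> 2 \<le> \<bar>i - j\<bar>" "(i = 1 \<and> j = 1) \<or> 4 \<le> i + j" using assms by presburger+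
  then show ?thesis using assms by (auto simp: even_part_def edge_weight_def)
qed

lemma odd_part_pos_odd:
  assumes "odd i" "odd j" "0 < i" "0 < j"
  shows "odd_part c i j = (if i = 1 \<and> j = 1 then (c - 1) / 2 else even_part c i j)"
proof -
  have "(i = 1 \<and> j = 1) \<or> 4 \<le> i + j" using assms by presburger
  then show ?thesis using assms by (auto simp: even_part_def odd_part_def edge_weight_def)
qed

lemma odd_part_le_even_part:
  assumes "odd i" "odd j" "0 < i" "0 < j" "1 \<le> c"
  shows "0 \<le> odd_part c i j" "odd_part c i j \<le> even_part c i j"
  using assms by (auto simp: odd_part_pos_odd even_part_pos_odd)

text \<open>Two incomparable pairs of admissible heights are \<open>(m + 2, m)\<close> and \<open>(m, m + 2)\<close>, so
  their join and meet both lie on the diagonal. This is where \<open>c \<ge> 1\<close> enters.\<close>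

lemma edge_lattice_ineq:
  fixes t :: real
  assumes i: "odd i" "0 < i" and j: "odd j" "0 < j" and i': "odd i'" "0 < i'" and j': "odd j'" "0 < j'"
    and c: "1 \<le> c" and t: "t \<in> {-1, 1}"
  defines "I \<equiv> max i i'" and "J \<equiv> max j j'" and "I' \<equiv> min i i'" and "J' \<equiv> min j j'"
  shows "\<bar>even_part c i j * even_part c i' j' + odd_part c i j * odd_part c i' j' * t\<bar>
      \<le> even_part c I J * even_part c I' J' + odd_part c I J * odd_part c I' J' * t"
    and "\<bar>odd_part c i j * even_part c i' j' + even_part c i j * odd_part c i' j' * t\<bar>
      \<le> odd_part c I J * even_part c I' J' + even_part c I J * odd_part c I' J' * t"
proof -
  let ?P = "\<lambda>i j i' j' I J I' J'.
    \<bar>even_part c i j * even_part c i' j' + odd_part c i j * odd_part c i' j' * t\<bar>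
      \<le> even_part c I J * even_part c I' J' + odd_part c I J * odd_part c I' J' * t \<and>
    \<bar>odd_part c i j * even_part c i' j' + even_part c i j * odd_part c i' j' * t\<bar>
      \<le> odd_part c I J * even_part c I' J' + even_part c I J * odd_part c I' J' * t"
  have comparable: "?P i j i' j' i' j' i j" "?P i' j' i j i' j' i j"
    if le: "i \<le> i'" "j \<le> j'" and i: "odd i" "0 < i" and j: "odd j" "0 < j"
      and i': "odd i'" "0 < i'" and j': "odd j'" "0 < j'" for i j i' j'
  proof -
    note bounds = odd_part_le_even_part[OF i(1) j(1) i(2) j(2) c]
      odd_part_le_even_part[OF i'(1) j'(1) i'(2) j'(2) c]
    have "odd_part c i j * odd_part c i' j' \<le> even_part c i j * even_part c i' j'"
      using bounds by (intro mult_mono) auto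
    \<comment> \<open>This is what \<open>t = -1\<close> requires in the second inequality: the sign
      coupling is at least as strong at the larger pair. The two parts differ only at
      \<open>(1, 1)\<close>, and a pair below \<open>(1, 1)\<close> equals it.\<close>
    moreover have "even_part c i' j' * odd_part c i j \<le> odd_part c i' j' * even_part c i j"
    proof (cases "i' = 1 \<and> j' = 1")
      case True
      then have "i = 1" "j = 1" using le i j by auto
      then show ?thesis using True by simp
    next
      case False
      then have "odd_part c i' j' = even_part c i' j'"
        using odd_part_pos_odd[OF i'(1) j'(1) i'(2) j'(2)] by auto
      then show ?thesis using bounds by (simp add: mult_left_mono)
    qed
    moreover have "0 \<le> odd_part c i j * odd_part c i' j'" "0 \<le> even_part c i' j' * odd_part c i j"
      using bounds by auto
    ultimately show "?P i j i' j' i' j' i j" "?P i' j' i j i' j' i j"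
      using t by (auto simp: mult.commute)
  qed
  have incomparable: "?P i j i' j' i j' i' j" "?P i' j' i j i j' i' j"
    if lt: "i' < i" "j < j'" and i: "odd i" "0 < i" and j: "odd j" "0 < j"
      and i': "odd i'" "0 < i'" and j': "odd j'" "0 < j'" for i j i' j'
  proof -
    \<comment> \<open>This bound and the next one make both right-hand sides nonnegative for either
      sign \<open>t\<close>, which settles the cases where an inadmissible pair makes the left-hand
      sides vanish.\<close>
    have nonneg: "\<bar>odd_part c i' j * even_part c i j'\<bar> \<le> odd_part c i j' * even_part c i' j"
    proof -
      have "odd_part c i j' = even_part c i j'"
        using odd_part_pos_odd[OF i(1) j'(1) i(2) j'(2)] lt j by auto
      then show ?thesis
        using odd_part_le_even_part[OF i'(1) j(1) i'(2) j(2) c]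
          odd_part_le_even_part[OF i(1) j'(1) i(2) j'(2) c]
        by (simp add: abs_mult mult.commute[of _ "even_part c i j'"] mult_left_mono)
    qed
    have nonneg': "\<bar>odd_part c i j' * odd_part c i' j\<bar> \<le> even_part c i j' * even_part c i' j"
      using odd_part_le_even_part[OF i'(1) j(1) i'(2) j(2) c]
          odd_part_le_even_part[OF i(1) j'(1) i(2) j'(2) c]
      by (simp add: abs_mult mult_mono)
    show "?P i j i' j' i j' i' j" "?P i' j' i j i j' i' j"
    proof -
      \<comment> \<open>By parity \<open>i - j\<close> and \<open>j' - i'\<close> add up to at least
        \<open>4\<close>. If neither exceeds \<open>2\<close> in absolute value, both equal
        \<open>2\<close> and all gaps are tight.\<close>
      consider "2 < \<bar>i - j\<bar>" | "2 < \<bar>i' - j'\<bar>" | "i = j + 2" "i' = j" "j' = j + 2"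
      proof -
        have "i' + 2 \<le> i" "j + 2 \<le> j'" using lt i j i' j' by presburger+
        then have "2 < \<bar>i - j\<bar> \<or> 2 < \<bar>i' - j'\<bar> \<or> (i = j + 2 \<and> i' = j \<and> j' = j + 2)" by linarith
        then show thesis using that by blast
      qed
      then have "?P i j i' j' i j' i' j \<and> ?P i' j' i j i j' i' j"
      proof cases
        case 1
        then have "even_part c i j = 0" "odd_part c i j = 0"
          using even_part_pos_odd[OF i(1) j(1) i(2) j(2)] odd_part_pos_odd[OF i(1) j(1) i(2) j(2)]
          by auto
        then show ?thesis using nonneg nonneg' t by (auto simp: mult.commute)
      next
        case 2
        then have "even_part c i' j' = 0" "odd_part c i' j' = 0"
          using even_part_pos_odd[OF i'(1) j'(1) i'(2) j'(2)] odd_part_pos_odd[OF i'(1) j'(1) i'(2) j'(2)]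
          by auto
        then show ?thesis using nonneg nonneg' t by (auto simp: mult.commute)
      next
        case 3
        \<comment> \<open>For \<open>t = 1\<close> the left-hand sides are \<open>1/2\<close> and
          the right-hand sides \<open>c * c / 2\<close>; for \<open>t = -1\<close> the left-hand
          sides vanish.\<close>
        have cc: "1 \<le> c * c" using c mult_mono[of 1 c 1 c] by simp
        have vals: "even_part c i j = 1/2" "odd_part c i j = 1/2" "even_part c i' j' = 1/2" "odd_part c i' j' = 1/2"
          "even_part c i j' = c/2" "odd_part c i j' = c/2"
          using i j i' j' 3 by (simp_all add: even_part_pos_odd odd_part_pos_odd)
        have vals': "even_part c i' j = (if j = 1 then (c + 1) / 2 else c / 2)"
          "odd_part c i' j = (if j = 1 then (c - 1) / 2 else c / 2)"
          using i j i' j' 3 by (simp_all add: even_part_pos_odd odd_part_pos_odd)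
        show ?thesis unfolding vals vals' using t c cc by (auto simp: field_simps)
      qed
      then show "?P i j i' j' i j' i' j" "?P i' j' i j i j' i' j" by blast+
    qed
  qed
  have "?P i j i' j' I J I' J'"
  proof -
    consider "i \<le> i'" "j \<le> j'" | "i' \<le> i" "j' \<le> j" | "i' < i" "j < j'" | "i < i'" "j' < j"
      by linarith
    then show ?thesis
    proof cases
      case 1
      then show ?thesis using comparable(1)[OF 1 i j i' j'] by (simp add: I_def J_def I'_def J'_def)
    next
      case 2
      then show ?thesis using comparable(2)[OF 2 i' j' i j] by (simp add: I_def J_def I'_def J'_def)
    next
      case 3
      then show ?thesis using incomparable(1)[OF 3 i j i' j'] by (simp add: I_def J_def I'_def J'_def)
    next
      case 4
      then show ?thesis using incomparable(2)[OF 4 i' j' i j] by (simp add: I_def J_def I'_def J'_def)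
    qed
  qed
  then show "\<bar>even_part c i j * even_part c i' j' + odd_part c i j * odd_part c i' j' * t\<bar>
      \<le> even_part c I J * even_part c I' J' + odd_part c I J * odd_part c I' J' * t"
    and "\<bar>odd_part c i j * even_part c i' j' + even_part c i j * odd_part c i' j' * t\<bar>
      \<le> odd_part c I J * even_part c I' J' + even_part c I J * odd_part c I' J' * t"
    by blast+
qed

text \<open>Edges are unordered; symmetric functions of the two end values can be evaluated at the
  larger and the smaller one.\<close>

definition on_edge :: "(int \<Rightarrow> int \<Rightarrow> real) \<Rightarrow> ('v \<Rightarrow> int) \<Rightarrow> 'v set \<Rightarrow> real" where
  "on_edge f k e = f (Max (k ` e)) (Min (k ` e))"

lemma on_edge_pair:
  assumes "\<And>i j. f i j = f j i"
  shows "on_edge f k {v, w} = f (k v) (k w)"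
  using assms by (simp add: on_edge_def max_def min_def)

text \<open>The defaults \<open>1\<close> here and \<open>0\<close> in \<open>odd_coeff\<close> make
  the Ising factor of an edge outside \<open>F\<close> equal to one.\<close>

definition even_coeff :: "'v set set \<Rightarrow> ('v set \<Rightarrow> real) \<Rightarrow> ('v \<Rightarrow> int) \<Rightarrow> 'v set \<Rightarrow> real" where
  "even_coeff F c k e = (if e \<in> F then on_edge (even_part (c e)) k e else 1)"

definition odd_coeff :: "'v set set \<Rightarrow> ('v set \<Rightarrow> real) \<Rightarrow> ('v \<Rightarrow> int) \<Rightarrow> 'v set \<Rightarrow> real" where
  "odd_coeff F c k e = (if e \<in> F then on_edge (odd_part (c e)) k e else 0)"

text \<open>Without loops the spin product over an edge is the product of the spins at its two
  ends.\<close>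

definition edges_in :: "'v set \<Rightarrow> 'v set set \<Rightarrow> bool" where
  "edges_in V F \<longleftrightarrow> (\<forall>e\<in>F. \<exists>v\<in>V. \<exists>w\<in>V. v \<noteq> w \<and> e = {v, w})"

lemma edges_in_obtain:
  assumes "edges_in V F" "e \<in> F"
  obtains v w where "v \<in> V" "w \<in> V" "v \<noteq> w" "e = {v, w}"
  using assms unfolding edges_in_def by blast

lemma edges_in_subset: "edges_in V F \<Longrightarrow> e \<in> F \<Longrightarrow> e \<subseteq> V"
  by (auto elim: edges_in_obtain)

lemma edges_in_finite:
  assumes "edges_in V F" "finite V"
  shows "finite F"
proof (rule finite_subset)
  show "F \<subseteq> Pow V" using edges_in_subset[OF assms(1)] by blast
qed (use assms in simp)

text \<open>Fixing the absolute heights \<open>k\<close> and summing the weight over signs gives an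
  Ising partition function: each edge weight splits into its even and odd parts, and edges outside
  \<open>F\<close> contribute factors one.\<close>

lemma ising_Z_coeff:
  assumes "edges_in V F'" "finite V" "F \<subseteq> F'"
  shows "ising_Z V F' (even_coeff F c k) (odd_coeff F c k) =
    (\<Sum>\<sigma>\<in>spins V. \<Prod>e\<in>F. on_edge (edge_weight (c e)) (\<lambda>v\<in>V. k v * \<sigma> v) e)"
  unfolding ising_Z_def
proof (rule sum.cong[OF refl])
  fix \<sigma> assume \<sigma>: "\<sigma> \<in> spins V"
  have "(\<Prod>e\<in>F'. even_coeff F c k e + odd_coeff F c k e * of_int (\<Prod>v\<in>e. \<sigma> v)) =
    (\<Prod>e\<in>F. even_coeff F c k e + odd_coeff F c k e * of_int (\<Prod>v\<in>e. \<sigma> v))"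
    using assms(3) edges_in_finite[OF assms(1,2)]
    by (intro prod.mono_neutral_right) (auto simp: even_coeff_def odd_coeff_def)
  also have "\<dots> = (\<Prod>e\<in>F. on_edge (edge_weight (c e)) (\<lambda>v\<in>V. k v * \<sigma> v) e)"
  proof (rule prod.cong[OF refl])
    fix e assume "e \<in> F"
    then obtain v w where e: "v \<in> V" "w \<in> V" "v \<noteq> w" "e = {v, w}"
      using assms edges_in_obtain by blast
    have "on_edge (edge_weight (c e)) (\<lambda>v\<in>V. k v * \<sigma> v) e = edge_weight (c e) (k v * \<sigma> v) (k w * \<sigma> w)"
      using e(1,2) unfolding e(4) by (subst on_edge_pair) (auto simp: edge_weight_commute)
    also have "\<dots> = even_part (c e) (k v) (k w) + odd_part (c e) (k v) (k w) * of_int (\<sigma> v * \<sigma> w)"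
      using PiE_mem[OF \<sigma>] e(1,2) by (intro edge_weight_spin)
    also have "\<sigma> v * \<sigma> w = (\<Prod>v\<in>e. \<sigma> v)" using e(3,4) by simp
    also have "even_part (c e) (k v) (k w) = even_coeff F c k e"
      using \<open>e \<in> F\<close> unfolding even_coeff_def e(4) by (simp add: on_edge_pair even_part_commute)
    also have "odd_part (c e) (k v) (k w) = odd_coeff F c k e"
      using \<open>e \<in> F\<close> unfolding odd_coeff_def e(4) by (simp add: on_edge_pair odd_part_commute)
    finally show "even_coeff F c k e + odd_coeff F c k e * of_int (\<Prod>v\<in>e. \<sigma> v) =
      on_edge (edge_weight (c e)) (\<lambda>v\<in>V. k v * \<sigma> v) e" by (rule sym)
  qed
  finally show "(\<Prod>e\<in>F'. even_coeff F c k e + odd_coeff F c k e * of_int (\<Prod>v\<in>e. \<sigma> v)) =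
    (\<Prod>e\<in>F. on_edge (edge_weight (c e)) (\<lambda>v\<in>V. k v * \<sigma> v) e)" .
qed

lemma ising_Z_coeff_nonneg:
  assumes "edges_in V F'" "finite V" "F \<subseteq> F'" "\<And>e. e \<in> F' \<Longrightarrow> 1 \<le> c e"
  shows "0 \<le> ising_Z V F' (even_coeff F c k) (odd_coeff F c k)"
proof -
  have "0 \<le> c e" if "e \<in> F" for e using assms(4)[of e] assms(3) that by auto
  then show ?thesis
    unfolding ising_Z_coeff[OF assms(1-3)]
    by (intro sum_nonneg prod_nonneg) (auto simp: on_edge_def edge_weight_def)
qed

section \<open>Lattice condition for absolute heights and their separation from signs\<close>

abbreviation pos_levels :: "int \<Rightarrow> int set" where
  "pos_levels M \<equiv> {i. odd i \<and> 0 < i \<and> i \<le> M}"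

abbreviation levels :: "int \<Rightarrow> int set" where
  "levels M \<equiv> {i. odd i \<and> \<bar>i\<bar> \<le> M}"

text \<open>The edges of the larger graph outside the smaller one carry no interaction for the smaller
  graph, which lets both partition functions live on the same lattice.\<close>

lemma ising_Z_coeff_lattice:
  assumes V: "edges_in V F'" "finite V" "F \<subseteq> F'" and c: "\<And>e. e \<in> F' \<Longrightarrow> 1 \<le> c e"
    and k: "k \<in> V \<rightarrow>\<^sub>E pos_levels M" and k': "k' \<in> V \<rightarrow>\<^sub>E pos_levels M"
    and one: "\<And>v. v \<in> V \<Longrightarrow> (\<exists>e\<in>F' - F. v \<in> e) \<Longrightarrow> k v = 1"
  shows "ising_Z V F' (even_coeff F c k) (odd_coeff F c k) *
      ising_Z V F' (even_coeff F' c k') (odd_coeff F' c k')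
    \<le> ising_Z V F' (even_coeff F c (\<lambda>v. min (k v) (k' v))) (odd_coeff F c (\<lambda>v. min (k v) (k' v))) *
      ising_Z V F' (even_coeff F' c (\<lambda>v. max (k v) (k' v))) (odd_coeff F' c (\<lambda>v. max (k v) (k' v)))"
    (is "?Z * ?Z' \<le> ?meet * ?join")
proof -
  have eval: "even_coeff F' c l {v, w} = even_part (c {v, w}) (l v) (l w)"
    "odd_coeff F' c l {v, w} = odd_part (c {v, w}) (l v) (l w)" if "{v, w} \<in> F'" for F' l v w
    using that by (simp_all add: even_coeff_def odd_coeff_def on_edge_pair even_part_commute odd_part_commute)
  have "?Z * ?Z' \<le> ?join * ?meet"
  proof (rule ising_Z_mult_mono)
    fix e and t :: real assume eF': "e \<in> F'" and t: "t \<in> {-1, 1}"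
    obtain v w where e: "v \<in> V" "w \<in> V" "e = {v, w}"
      using V(1) eF' by (rule edges_in_obtain)
    have kv: "odd (k v)" "0 < k v" "odd (k w)" "0 < k w" "odd (k' v)" "0 < k' v" "odd (k' w)" "0 < k' w"
      using PiE_mem[OF k e(1)] PiE_mem[OF k e(2)] PiE_mem[OF k' e(1)] PiE_mem[OF k' e(2)] by auto
    have ce: "1 \<le> c e" using c eF' .
    have "\<bar>even_coeff F c k e * even_coeff F' c k' e + odd_coeff F c k e * odd_coeff F' c k' e * t\<bar>
      \<le> even_coeff F' c (\<lambda>v. max (k v) (k' v)) e * even_coeff F c (\<lambda>v. min (k v) (k' v)) e +
         odd_coeff F' c (\<lambda>v. max (k v) (k' v)) e * odd_coeff F c (\<lambda>v. min (k v) (k' v)) e * t \<and>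
     \<bar>odd_coeff F c k e * even_coeff F' c k' e + even_coeff F c k e * odd_coeff F' c k' e * t\<bar>
      \<le> odd_coeff F' c (\<lambda>v. max (k v) (k' v)) e * even_coeff F c (\<lambda>v. min (k v) (k' v)) e +
         even_coeff F' c (\<lambda>v. max (k v) (k' v)) e * odd_coeff F c (\<lambda>v. min (k v) (k' v)) e * t"
    proof (cases "e \<in> F")
      case True
      then show ?thesis
        using edge_lattice_ineq[OF kv ce t] eF' unfolding e(3) by (simp only: eval simp_thms)
    next
      \<comment> \<open>The coefficients for \<open>k\<close> are \<open>1\<close> and
        \<open>0\<close> here. As \<open>k = 1\<close> at both ends, the join agrees with
        \<open>k'\<close> on \<open>e\<close>, so both sides carry the same coefficients of
        \<open>k'\<close>.\<close>
      case False
      then have "\<exists>e\<in>F' - F. v \<in> e" "\<exists>e\<in>F' - F. w \<in> e" using e(3) eF' by blast+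
      then have "k v = 1" "k w = 1" using one e(1,2) by blast+
      then have "on_edge f (\<lambda>v. max (k v) (k' v)) e = on_edge f k' e" for f
        using kv unfolding e(3) on_edge_def by simp
      then show ?thesis
        using False eF' odd_part_le_even_part[OF kv(5,7,6,8) ce] t
        by (auto simp: even_coeff_def odd_coeff_def e(3) on_edge_pair even_part_commute odd_part_commute)
    qed
    then show "\<bar>even_coeff F c k e * even_coeff F' c k' e + odd_coeff F c k e * odd_coeff F' c k' e * t\<bar>
      \<le> even_coeff F' c (\<lambda>v. max (k v) (k' v)) e * even_coeff F c (\<lambda>v. min (k v) (k' v)) e +
         odd_coeff F' c (\<lambda>v. max (k v) (k' v)) e * odd_coeff F c (\<lambda>v. min (k v) (k' v)) e * t"
     "\<bar>odd_coeff F c k e * even_coeff F' c k' e + even_coeff F c k e * odd_coeff F' c k' e * t\<bar>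
      \<le> odd_coeff F' c (\<lambda>v. max (k v) (k' v)) e * even_coeff F c (\<lambda>v. min (k v) (k' v)) e +
         even_coeff F' c (\<lambda>v. max (k v) (k' v)) e * odd_coeff F c (\<lambda>v. min (k v) (k' v)) e * t"
      by blast+
  qed (use V edges_in_subset edges_in_finite in blast)+
  then show ?thesis by (simp add: mult.commute)
qed

text \<open>Odd heights are nonzero, so each factors uniquely into its absolute value and its
  sign.\<close>

lemma sum_levels_spins:
  fixes G :: "('v \<Rightarrow> int) \<Rightarrow> real"
  shows "(\<Sum>k\<in>V \<rightarrow>\<^sub>E pos_levels M. \<Sum>\<sigma>\<in>spins V. G (\<lambda>v\<in>V. k v * \<sigma> v)) = (\<Sum>h\<in>V \<rightarrow>\<^sub>E levels M. G h)"
proof -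
  have "(\<Sum>k\<in>V \<rightarrow>\<^sub>E pos_levels M. \<Sum>\<sigma>\<in>spins V. G (\<lambda>v\<in>V. k v * \<sigma> v)) =
    (\<Sum>(k, \<sigma>)\<in>(V \<rightarrow>\<^sub>E pos_levels M) \<times> spins V. G (\<lambda>v\<in>V. k v * \<sigma> v))"
    by (rule sum.cartesian_product)
  also have "\<dots> = (\<Sum>h\<in>V \<rightarrow>\<^sub>E levels M. G h)"
  proof (rule sum.reindex_bij_witness[where i = "\<lambda>h. (\<lambda>v\<in>V. \<bar>h v\<bar>, \<lambda>v\<in>V. sgn (h v))"
        and j = "\<lambda>(k, \<sigma>). \<lambda>v\<in>V. k v * \<sigma> v"])
    fix p assume "p \<in> (V \<rightarrow>\<^sub>E pos_levels M) \<times> spins V"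
    then obtain k \<sigma> where p: "p = (k, \<sigma>)" "k \<in> V \<rightarrow>\<^sub>E pos_levels M" "\<sigma> \<in> spins V" by auto
    have v: "odd (k v)" "0 < k v" "k v \<le> M" "\<sigma> v = -1 \<or> \<sigma> v = 1" if "v \<in> V" for v
      using PiE_mem[OF p(2) that] PiE_mem[OF p(3) that] by auto
    have "(\<lambda>v\<in>V. \<bar>k v * \<sigma> v\<bar>) = k" "(\<lambda>v\<in>V. sgn (k v * \<sigma> v)) = \<sigma>"
      using v(2,4) PiE_arb[OF p(2)] PiE_arb[OF p(3)]
      by (fastforce simp: fun_eq_iff restrict_def abs_mult sgn_mult)+
    then show "(\<lambda>h. (\<lambda>v\<in>V. \<bar>h v\<bar>, \<lambda>v\<in>V. sgn (h v))) ((\<lambda>(k, \<sigma>). \<lambda>v\<in>V. k v * \<sigma> v) p) = p"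
      unfolding p(1) by (simp add: restrict_def cong: if_cong)
    show "(\<lambda>(k, \<sigma>). \<lambda>v\<in>V. k v * \<sigma> v) p \<in> V \<rightarrow>\<^sub>E levels M"
      unfolding p(1) prod.case
    proof (rule restrict_PiE_iff[THEN iffD2], rule ballI)
      fix u assume "u \<in> V"
      from v[OF this] show "k u * \<sigma> u \<in> levels M" by auto
    qed
    show "G ((\<lambda>(k, \<sigma>). \<lambda>v\<in>V. k v * \<sigma> v) p) = (case p of (k, \<sigma>) \<Rightarrow> G (\<lambda>v\<in>V. k v * \<sigma> v))"
      unfolding p(1) prod.case ..
  next
    fix h assume h: "h \<in> V \<rightarrow>\<^sub>E levels M"
    have v: "odd (h v)" "\<bar>h v\<bar> \<le> M" "h v \<noteq> 0" if "v \<in> V" for v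
      using PiE_mem[OF h that] by auto
    show "(\<lambda>(k, \<sigma>). \<lambda>v\<in>V. k v * \<sigma> v) (\<lambda>v\<in>V. \<bar>h v\<bar>, \<lambda>v\<in>V. sgn (h v)) = h"
      using PiE_arb[OF h] by (auto simp: fun_eq_iff abs_mult_sgn)
    show "(\<lambda>v\<in>V. \<bar>h v\<bar>, \<lambda>v\<in>V. sgn (h v)) \<in> (V \<rightarrow>\<^sub>E pos_levels M) \<times> spins V"
      using v by (auto simp: sgn_if)
  qed
  finally show ?thesis .
qed

section \<open>Height functions on finite subgraphs\<close>

locale height_model =
  fixes E :: "'v \<Rightarrow> 'v \<Rightarrow> bool" and c :: "'v set \<Rightarrow> real"
  assumes infinite: "infinite (UNIV :: 'v set)"
    and sym: "E v w \<Longrightarrow> E w v"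
    and irrefl: "\<not> E v v"
    and connected: "E\<^sup>*\<^sup>* v w"
    and weights: "e \<in> Gedges E \<Longrightarrow> c e \<ge> 1"
begin

lemma subgraph_edges_in:
  assumes "fin_conn_subgraph E D"
  shows "edges_in (fst D) (snd D)"
  unfolding edges_in_def
proof
  fix e assume e: "e \<in> snd D"
  then obtain v w where vw: "E v w" "e = {v, w}"
    using assms unfolding fin_conn_subgraph_def Gedges_def by blast
  have "v \<noteq> w" using vw(1) irrefl by auto
  moreover have "e \<subseteq> fst D" using assms e unfolding fin_conn_subgraph_def by blast
  ultimately show "\<exists>v\<in>fst D. \<exists>w\<in>fst D. v \<noteq> w \<and> e = {v, w}" using vw(2) by blast
qed

lemma subgraph_finite:
  assumes "fin_conn_subgraph E D"
  shows "finite (fst D)" "finite (snd D)"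
  using assms edges_in_finite[OF subgraph_edges_in[OF assms]] by (auto simp: fin_conn_subgraph_def)

lemma subgraph_weights: "fin_conn_subgraph E D \<Longrightarrow> e \<in> snd D \<Longrightarrow> 1 \<le> c e"
  using weights by (auto simp: fin_conn_subgraph_def)

text \<open>Without boundary, every edge at a vertex of \<open>D\<close> lies in \<open>D\<close>,
  so connectedness of the ambient graph would make the finite vertex set of \<open>D\<close>
  everything.\<close>

lemma bdry_nonempty:
  assumes "fin_conn_subgraph E D"
  shows "bdry E D \<noteq> {}"
proof
  assume none: "bdry E D = {}"
  obtain x where x: "x \<in> fst D" using assms by (auto simp: fin_conn_subgraph_def)
  have "y \<in> fst D" for y
    using connected[of x y]
  proof (induction rule: rtranclp_induct)
    case (step v w)
    then have "{v, w} \<in> snd D" using none by (auto simp: bdry_def)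
    then show ?case using edges_in_subset[OF subgraph_edges_in[OF assms]] by blast
  qed (rule x)
  then have "fst D = UNIV" by blast
  then show False using subgraph_finite(1)[OF assms] infinite by simp
qed

text \<open>Along a path in \<open>D\<close> from a boundary vertex, where
  \<open>\<bar>h\<bar> = 1\<close>, the height changes by at most \<open>2\<close> per edge.\<close>

lemma height_funs_bound_at:
  assumes "fin_conn_subgraph E D" "x \<in> fst D"
  shows "\<exists>B. \<forall>h\<in>height_funs E D. \<bar>h x\<bar> \<le> B"
proof -
  obtain b where b: "b \<in> bdry E D" using bdry_nonempty[OF assms(1)] by blast
  then have "b \<in> fst D" by (simp add: bdry_def)
  then have "(\<lambda>v w. {v, w} \<in> snd D)\<^sup>*\<^sup>* b x" using assms by (simp add: fin_conn_subgraph_def)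
  then show ?thesis
  proof (induction rule: rtranclp_induct)
    case base
    have "\<bar>h b\<bar> \<le> 1" if "h \<in> height_funs E D" for h
      using that b by (auto simp: height_funs_def)
    then show ?case by blast
  next
    case (step v w)
    then obtain B where B: "\<forall>h\<in>height_funs E D. \<bar>h v\<bar> \<le> B" by blast
    have "\<bar>h w\<bar> \<le> B + 2" if h: "h \<in> height_funs E D" for h
    proof -
      have "\<bar>h v - h w\<bar> \<le> 2" using h step(2) by (simp add: height_funs_def)
      then show ?thesis using B h by force
    qed
    then show ?case by blast
  qed
qed

lemma height_funs_bound:
  assumes "fin_conn_subgraph E D"
  shows "\<exists>M. \<forall>h\<in>height_funs E D. \<forall>x\<in>fst D. \<bar>h x\<bar> \<le> M"
proof -
  obtain B where B: "\<forall>x\<in>fst D. \<forall>h\<in>height_funs E D. \<bar>h x\<bar> \<le> B x"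
    using height_funs_bound_at[OF assms] by metis
  have "\<bar>h x\<bar> \<le> Max (B ` fst D)" if "h \<in> height_funs E D" "x \<in> fst D" for h x
  proof -
    have "\<bar>h x\<bar> \<le> B x" using B that by blast
    also have "\<dots> \<le> Max (B ` fst D)" using that subgraph_finite(1)[OF assms] by simp
    finally show ?thesis .
  qed
  then show ?thesis by blast
qed

lemma height_funs_finite:
  assumes "fin_conn_subgraph E D"
  shows "finite (height_funs E D)"
proof -
  obtain M where M: "\<forall>h\<in>height_funs E D. \<forall>x\<in>fst D. \<bar>h x\<bar> \<le> M"
    using height_funs_bound[OF assms] by blast
  show ?thesis
  proof (rule finite_subset)
    show "height_funs E D \<subseteq> {h. \<forall>x. (x \<in> fst D \<longrightarrow> h x \<in> {-M..M}) \<and> (x \<notin> fst D \<longrightarrow> h x = 0)}"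
      using M by (auto simp: height_funs_def abs_le_iff) (smt (verit))
    show "finite {h. \<forall>x. (x \<in> fst D \<longrightarrow> h x \<in> {-M..M}) \<and> (x \<notin> fst D \<longrightarrow> h x = (0::int))}"
      using subgraph_finite(1)[OF assms] by (intro finite_set_of_finite_funs) auto
  qed
qed

section \<open>Weights and partition functions\<close>

lemma hweight_pos:
  assumes "fin_conn_subgraph E D"
  shows "0 < hweight c D h"
  unfolding hweight_def
proof (intro prod_pos zero_less_power)
  fix e assume "e \<in> snd D"
  then show "0 < c e" using subgraph_weights[OF assms, of e] by simp
qed

lemma partition_function_pos:
  assumes "fin_conn_subgraph E D"
  shows "0 < (\<Sum>h\<in>height_funs E D. hweight c D h)"
proof (rule sum_pos)
  have "(\<lambda>v. if v \<in> fst D then 1 else 0) \<in> height_funs E D"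
    by (auto simp: height_funs_def bdry_def)
  then show "height_funs E D \<noteq> {}" by blast
qed (simp_all add: height_funs_finite hweight_pos assms)

lemma hweight_eq_prod_edge_weight:
  assumes "fin_conn_subgraph E D" "h \<in> height_funs E D"
  shows "hweight c D h = (\<Prod>e\<in>snd D. on_edge (edge_weight (c e)) h e)"
  unfolding hweight_def
proof (rule prod.cong[OF refl])
  fix e assume e: "e \<in> snd D"
  then obtain v w where vw: "v \<noteq> w" "e = {v, w}"
    using edges_in_obtain[OF subgraph_edges_in[OF assms(1)]] by metis
  have "\<bar>h v - h w\<bar> \<le> 2" using assms(2) e vw(2) by (simp add: height_funs_def)
  moreover have "(\<exists>v' w'. {v, w} = {v', w'} \<and> h v' = h w') \<longleftrightarrow> h v = h w"
    by (auto simp: doubleton_eq_iff)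
  ultimately show "c e ^ (if \<exists>v w. e = {v, w} \<and> h v = h w then 1 else 0) =
      on_edge (edge_weight (c e)) h e"
    unfolding vw(2) by (subst on_edge_pair) (auto simp: edge_weight_commute edge_weight_def)
qed

text \<open>This puts the model on \<open>D\<close> on a larger vertex set: each vertex outside
  \<open>D\<close> gets a height \<open>1\<close> or \<open>-1\<close>, meets no edge of
  \<open>D\<close> and so contributes a factor \<open>2\<close>. The function \<phi> covers second
  moment and normalisation at once.\<close>

lemma sum_height_funs_extend:
  assumes D: "fin_conn_subgraph E D" and V: "fst D \<subseteq> V" "finite V"
    and M: "\<forall>h\<in>height_funs E D. \<forall>v\<in>fst D. \<bar>h v\<bar> \<le> M" and M1: "1 \<le> M" and x: "x \<in> fst D"
  shows "(\<Sum>h\<in>V \<rightarrow>\<^sub>E levels M. of_bool (\<forall>v\<in>bdry E D \<union> (V - fst D). \<bar>h v\<bar> = 1) *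
        (\<Prod>e\<in>snd D. on_edge (edge_weight (c e)) h e) * \<phi> \<bar>h x\<bar>) =
      2 ^ card (V - fst D) * (\<Sum>h\<in>height_funs E D. hweight c D h * \<phi> \<bar>h x\<bar>)"
proof -
  define U where "U = V - fst D"
  define ext where "ext h g = (\<lambda>v. if v \<in> fst D then h v else g v)" for h g :: "'v \<Rightarrow> int"
  define T where "T h = of_bool (\<forall>v\<in>bdry E D \<union> (V - fst D). \<bar>h v\<bar> = 1) *
        (\<Prod>e\<in>snd D. on_edge (edge_weight (c e)) h e) * \<phi> \<bar>h x\<bar>" for h
  \<comment> \<open>\<open>A\<close> collects the configurations that violate neither the indicator
    nor an edge constraint; all other terms vanish.\<close>
  define A where "A = {h \<in> V \<rightarrow>\<^sub>E levels M. (\<forall>v\<in>bdry E D \<union> (V - fst D). \<bar>h v\<bar> = 1) \<and>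
      (\<forall>v w. {v, w} \<in> snd D \<longrightarrow> \<bar>h v - h w\<bar> \<le> 2)}"
  have edges: "v \<in> fst D" "w \<in> fst D" if "{v, w} \<in> snd D" for v w
    using edges_in_subset[OF subgraph_edges_in[OF D] that] by auto
  have lev: "levels M = {i. odd i} \<inter> {-M..M}" by auto
  have "sum T (V \<rightarrow>\<^sub>E levels M) = sum T A"
  proof (rule sum.mono_neutral_right)
    show "finite (V \<rightarrow>\<^sub>E levels M)" using V(2) unfolding lev by (intro finite_PiE) auto
    show "\<forall>h\<in>(V \<rightarrow>\<^sub>E levels M) - A. T h = 0"
    proof
      fix h assume "h \<in> (V \<rightarrow>\<^sub>E levels M) - A"
      then consider "\<not> (\<forall>v\<in>bdry E D \<union> (V - fst D). \<bar>h v\<bar> = 1)"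
        | v w where "{v, w} \<in> snd D" "\<not> \<bar>h v - h w\<bar> \<le> 2"
        unfolding A_def by blast
      then show "T h = 0"
      proof cases
        case 1
        then show ?thesis unfolding T_def by simp
      next
        case 2
        then have "on_edge (edge_weight (c {v, w})) h {v, w} = 0"
          by (subst on_edge_pair) (auto simp: edge_weight_commute edge_weight_def)
        then have "(\<Prod>e\<in>snd D. on_edge (edge_weight (c e)) h e) = 0"
          using 2(1) subgraph_finite(2)[OF D] by (intro prod_zero) auto
        then show ?thesis unfolding T_def by simp
      qed
    qed
  qed (auto simp: A_def)
  also have "\<dots> = (\<Sum>(h, g)\<in>height_funs E D \<times> spins U. hweight c D h * \<phi> \<bar>h x\<bar>)"
  \<comment> \<open>The inverse map must restore two default values: height functions are
    \<open>0\<close> outside \<open>D\<close>, whereas spins are \<open>undefined\<close> outside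
    \<open>U\<close>.\<close>
  proof (rule sum.reindex_bij_witness[symmetric, where j = "\<lambda>(h, g). ext h g"
        and i = "\<lambda>h. (\<lambda>v. if v \<in> fst D then h v else 0, \<lambda>v\<in>U. h v)"])
    fix p assume "p \<in> height_funs E D \<times> spins U"
    then obtain h g where p: "p = (h, g)" "h \<in> height_funs E D" "g \<in> spins U" by auto
    have g: "g v = -1 \<or> g v = 1" if "v \<in> U" for v using PiE_mem[OF p(3) that] by auto
    have "(\<lambda>v. if v \<in> fst D then ext h g v else 0) = h"
      using p(2) by (auto simp: ext_def height_funs_def)
    moreover have "(\<lambda>v\<in>U. ext h g v) = g"
      using PiE_arb[OF p(3)] by (auto simp: ext_def U_def fun_eq_iff)
    ultimately show "(\<lambda>h. (\<lambda>v. if v \<in> fst D then h v else 0, \<lambda>v\<in>U. h v)) ((\<lambda>(h, g). ext h g) p) = p"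
      unfolding p(1) by (simp cong: if_cong)
    have bd: "\<bar>ext h g v\<bar> = 1" if "v \<in> bdry E D \<union> (V - fst D)" for v
      using that p(2) g[of v] by (auto simp: ext_def U_def height_funs_def bdry_def)
    have "ext h g \<in> V \<rightarrow>\<^sub>E levels M"
    proof (rule PiE_I)
      fix v assume "v \<in> V"
      then show "ext h g v \<in> levels M"
        using p(2) g[of v] M M1 by (auto simp: ext_def U_def height_funs_def)
    next
      fix v assume "v \<notin> V"
      then show "ext h g v = undefined" using V(1) PiE_arb[OF p(3)] by (auto simp: ext_def U_def)
    qed
    moreover have "\<bar>ext h g v - ext h g w\<bar> \<le> 2" if "{v, w} \<in> snd D" for v w
      using p(2) edges[OF that] that by (simp add: ext_def height_funs_def)
    ultimately show "(\<lambda>(h, g). ext h g) p \<in> A" unfolding p(1) A_def using bd by auto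
    have "on_edge f (ext h g) e = on_edge f h e" if "e \<in> snd D" for f e
    proof -
      have "ext h g ` e = h ` e"
        using edges_in_subset[OF subgraph_edges_in[OF D] that] by (auto simp: ext_def intro!: image_cong)
      then show ?thesis by (simp add: on_edge_def)
    qed
    then have "(\<Prod>e\<in>snd D. on_edge (edge_weight (c e)) (ext h g) e) = hweight c D h"
      unfolding hweight_eq_prod_edge_weight[OF D p(2)] by (intro prod.cong) auto
    then show "T ((\<lambda>(h, g). ext h g) p) = (case p of (h, g) \<Rightarrow> hweight c D h * \<phi> \<bar>h x\<bar>)"
      unfolding p(1) T_def using bd x by (simp add: ext_def)
  next
    fix h assume h: "h \<in> A"
    then have hP: "h \<in> V \<rightarrow>\<^sub>E levels M" by (simp add: A_def)
    show "(\<lambda>(h, g). ext h g) (\<lambda>v. if v \<in> fst D then h v else 0, \<lambda>v\<in>U. h v) = h"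
      using PiE_arb[OF hP] by (auto simp: ext_def U_def fun_eq_iff)
    have "(\<lambda>v. if v \<in> fst D then h v else 0) \<in> height_funs E D"
      using h V(1) PiE_mem[OF hP] edges
      by (auto simp: height_funs_def A_def bdry_def abs_if split: if_splits)
    moreover have "(\<lambda>v\<in>U. h v) \<in> spins U"
      using h by (auto simp: A_def U_def abs_if split: if_splits)
    ultimately show "(\<lambda>v. if v \<in> fst D then h v else 0, \<lambda>v\<in>U. h v) \<in> height_funs E D \<times> spins U"
      by blast
  qed
  also have "\<dots> = (\<Sum>h\<in>height_funs E D. \<Sum>g\<in>spins U. hweight c D h * \<phi> \<bar>h x\<bar>)"
    by (rule sum.cartesian_product[symmetric])
  also have "\<dots> = 2 ^ card U * (\<Sum>h\<in>height_funs E D. hweight c D h * \<phi> \<bar>h x\<bar>)"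
    using V(2) by (simp add: card_PiE U_def sum_distrib_left numeral_2_eq_2)
  finally show ?thesis unfolding T_def U_def .
qed

text \<open>Height functions on \<open>D\<close>, with free signs added outside, are grouped by
  their absolute value \<open>k\<close>; the sum over signs is the Ising partition function. Both
  the boundary condition and the extension become the condition \<open>k = 1\<close>.\<close>

lemma sum_abs_heights:
  assumes D: "fin_conn_subgraph E D" and D': "fin_conn_subgraph E D'" and le: "subgraph_le D D'"
    and M: "\<forall>h\<in>height_funs E D. \<forall>v\<in>fst D. \<bar>h v\<bar> \<le> M" "1 \<le> M" and x: "x \<in> fst D"
  shows "(\<Sum>k\<in>fst D' \<rightarrow>\<^sub>E pos_levels M. of_bool (\<forall>v\<in>bdry E D \<union> (fst D' - fst D). k v = 1) *
        ising_Z (fst D') (snd D') (even_coeff (snd D) c k) (odd_coeff (snd D) c k) * \<phi> (k x)) =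
      2 ^ card (fst D' - fst D) * (\<Sum>h\<in>height_funs E D. hweight c D h * \<phi> \<bar>h x\<bar>)"
    (is "(\<Sum>k\<in>?K. of_bool (?b k) * ?Z k * _) = _")
proof -
  define V where "V = fst D'"
  have sub: "fst D \<subseteq> V" "snd D \<subseteq> snd D'" using le by (auto simp: subgraph_le_def V_def)
  define G where "G h = of_bool (\<forall>v\<in>bdry E D \<union> (V - fst D). \<bar>h v\<bar> = 1) *
        (\<Prod>e\<in>snd D. on_edge (edge_weight (c e)) h e) * \<phi> \<bar>h x\<bar>" for h
  have "(\<Sum>k\<in>?K. of_bool (?b k) * ?Z k * \<phi> (k x)) = (\<Sum>k\<in>?K. \<Sum>\<sigma>\<in>spins V. G (\<lambda>v\<in>V. k v * \<sigma> v))"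
  proof (rule sum.cong[OF refl])
    fix k assume k: "k \<in> ?K"
    have "G (\<lambda>v\<in>V. k v * \<sigma> v) = of_bool (?b k) * \<phi> (k x) *
        (\<Prod>e\<in>snd D. on_edge (edge_weight (c e)) (\<lambda>v\<in>V. k v * \<sigma> v) e)" if \<sigma>: "\<sigma> \<in> spins V" for \<sigma>
    proof -
      have abs: "\<bar>(\<lambda>v\<in>V. k v * \<sigma> v) v\<bar> = k v" if "v \<in> V" for v
        using PiE_mem[OF \<sigma> that] PiE_mem[OF k, of v] that by (auto simp: V_def abs_mult)
      have "v \<in> V" if "v \<in> bdry E D \<union> (V - fst D)" for v
        using that sub(1) by (auto simp: bdry_def)
      then have "(\<forall>v\<in>bdry E D \<union> (V - fst D). \<bar>(\<lambda>v\<in>V. k v * \<sigma> v) v\<bar> = 1) \<longleftrightarrow> ?b k"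
        unfolding V_def[symmetric] by (intro ball_cong refl) (simp only: abs)
      moreover have "\<bar>(\<lambda>v\<in>V. k v * \<sigma> v) x\<bar> = k x" using abs sub(1) x by blast
      ultimately show ?thesis unfolding G_def by (simp only: mult_ac)
    qed
    then have "(\<Sum>\<sigma>\<in>spins V. G (\<lambda>v\<in>V. k v * \<sigma> v)) = of_bool (?b k) * \<phi> (k x) *
        (\<Sum>\<sigma>\<in>spins V. \<Prod>e\<in>snd D. on_edge (edge_weight (c e)) (\<lambda>v\<in>V. k v * \<sigma> v) e)"
      unfolding sum_distrib_left by (intro sum.cong refl)
    also have "(\<Sum>\<sigma>\<in>spins V. \<Prod>e\<in>snd D. on_edge (edge_weight (c e)) (\<lambda>v\<in>V. k v * \<sigma> v) e) = ?Z k"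
      unfolding V_def
      by (rule ising_Z_coeff[OF subgraph_edges_in[OF D'] subgraph_finite(1)[OF D'] sub(2), symmetric])
    finally show "of_bool (?b k) * ?Z k * \<phi> (k x) = (\<Sum>\<sigma>\<in>spins V. G (\<lambda>v\<in>V. k v * \<sigma> v))"
      by (simp only: mult_ac)
  qed
  also have "\<dots> = sum G (V \<rightarrow>\<^sub>E levels M)"
    unfolding V_def[symmetric] by (rule sum_levels_spins)
  also have "\<dots> = 2 ^ card (V - fst D) * (\<Sum>h\<in>height_funs E D. hweight c D h * \<phi> \<bar>h x\<bar>)"
    unfolding G_def
    by (rule sum_height_funs_extend[OF D sub(1) _ M x]) (simp add: V_def subgraph_finite(1)[OF D'])
  finally show ?thesis unfolding V_def .
qed

text \<open>The four functions are \<open>Z1 * k(x)^2\<close>, \<open>Z2\<close>, \<open>Z1\<close>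
  and \<open>Z2 * k(x)^2\<close>. The resulting inequality is the cross-multiplied comparison of the
  two second moments.\<close>

theorem Eh2_mono:
  assumes D: "fin_conn_subgraph E D" and D': "fin_conn_subgraph E D'" and le: "subgraph_le D D'"
    and x: "x \<in> fst D"
  shows "Eh2 E c D x \<le> Eh2 E c D' x"
proof -
  obtain M1 M2 where "\<forall>h\<in>height_funs E D. \<forall>v\<in>fst D. \<bar>h v\<bar> \<le> M1"
    "\<forall>h\<in>height_funs E D'. \<forall>v\<in>fst D'. \<bar>h v\<bar> \<le> M2"
    using height_funs_bound[OF D] height_funs_bound[OF D'] by blast
  \<comment> \<open>Truncating both models at a common level that bounds all their heights loses
    nothing; the level is at least \<open>1\<close> to admit the added spins.\<close>
  moreover define M where "M = max 1 (max M1 M2)"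
  ultimately have M: "\<forall>h\<in>height_funs E D. \<forall>v\<in>fst D. \<bar>h v\<bar> \<le> M"
    "\<forall>h\<in>height_funs E D'. \<forall>v\<in>fst D'. \<bar>h v\<bar> \<le> M" "1 \<le> M"
    by (force simp: le_max_iff_disj)+
  define V F F' where "V = fst D'" and "F = snd D" and "F' = snd D'"
  define K where "K = (V \<rightarrow>\<^sub>E pos_levels M)"
  define B where "B = bdry E D \<union> (V - fst D)"
  define Z1 where "Z1 k = of_bool (\<forall>v\<in>B. k v = 1) *
    ising_Z V F' (even_coeff F c k) (odd_coeff F c k)" for k
  define Z2 where "Z2 k = of_bool (\<forall>v\<in>bdry E D'. k v = 1) *
    ising_Z V F' (even_coeff F' c k) (odd_coeff F' c k)" for k
  define num den where "num D = (\<Sum>h\<in>height_funs E D. hweight c D h * (real_of_int (h x))\<^sup>2)"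
    and "den D = (\<Sum>h\<in>height_funs E D. hweight c D h)" for D
  define N :: real where "N = 2 ^ card (V - fst D)"
  have sub: "fst D \<subseteq> V" "F \<subseteq> F'" using le by (auto simp: subgraph_le_def V_def F_def F'_def)
  have V: "edges_in V F'" "finite V" "\<And>e. e \<in> F' \<Longrightarrow> 1 \<le> c e"
    unfolding V_def F'_def
    using subgraph_edges_in[OF D'] subgraph_finite(1)[OF D'] subgraph_weights[OF D'] by auto
  have x': "x \<in> fst D'" using x le by (auto simp: subgraph_le_def)
  have refl: "subgraph_le D' D'" by (simp add: subgraph_le_def)
  have num1: "(\<Sum>k\<in>K. Z1 k * (real_of_int (k x))\<^sup>2) = N * num D"
    and den1: "(\<Sum>k\<in>K. Z1 k) = N * den D"
    using sum_abs_heights[OF D D' le M(1,3) x, of "\<lambda>i. (real_of_int i)\<^sup>2"]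
      sum_abs_heights[OF D D' le M(1,3) x, of "\<lambda>_. 1"]
    by (simp_all add: K_def Z1_def N_def num_def den_def V_def F_def F'_def B_def)
  have num2: "(\<Sum>k\<in>K. Z2 k * (real_of_int (k x))\<^sup>2) = num D'"
    and den2: "(\<Sum>k\<in>K. Z2 k) = den D'"
    using sum_abs_heights[OF D' D' refl M(2,3) x', of "\<lambda>i. (real_of_int i)\<^sup>2"]
      sum_abs_heights[OF D' D' refl M(2,3) x', of "\<lambda>_. 1"]
    by (simp_all add: K_def Z2_def num_def den_def V_def F'_def)
  \<comment> \<open>A vertex of \<open>D\<close> with an edge missing from \<open>D'\<close> also
    misses that edge in \<open>D\<close>.\<close>
  have bdry': "v \<in> B" if "v \<in> bdry E D'" for v
    using that sub(2) by (auto simp: B_def V_def F_def F'_def bdry_def)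
  \<comment> \<open>An end of a new edge either lies outside \<open>D\<close> or is a boundary
    vertex of \<open>D\<close>, because the new edge is missing there.\<close>
  have new_edges: "v \<in> B" if v: "v \<in> V" "\<exists>e\<in>F' - F. v \<in> e" for v
  proof -
    obtain e where e: "e \<in> F'" "e \<notin> F" "v \<in> e" using v(2) by blast
    then obtain a b where ab: "E a b" "e = {a, b}"
      using D' unfolding fin_conn_subgraph_def Gedges_def F'_def by blast
    then obtain w where "E v w" "e = {v, w}" using e(3) sym[of a b] by auto
    then show ?thesis using v(1) e(2) by (auto simp: B_def bdry_def F_def)
  qed
  have "(\<Sum>k\<in>K. Z1 k * (real_of_int (k x))\<^sup>2) * (\<Sum>k\<in>K. Z2 k)
      \<le> (\<Sum>k\<in>K. Z1 k) * (\<Sum>k\<in>K. Z2 k * (real_of_int (k x))\<^sup>2)"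
    unfolding K_def
  proof (rule four_functions_PiE[OF V(2)])
    have nonneg: "0 \<le> Z1 k" "0 \<le> Z2 k" for k
      unfolding Z1_def Z2_def using ising_Z_coeff_nonneg[OF V(1,2) _ V(3)] sub(2) by simp_all
    show "0 \<le> Z1 k * (real_of_int (k x))\<^sup>2 \<and> 0 \<le> Z2 k \<and> 0 \<le> Z1 k \<and> 0 \<le> Z2 k * (real_of_int (k x))\<^sup>2" for k
      using nonneg by simp
    fix k k' assume k: "k \<in> V \<rightarrow>\<^sub>E pos_levels M" and k': "k' \<in> V \<rightarrow>\<^sub>E pos_levels M"
    have "Z1 k * Z2 k' \<le> Z1 (\<lambda>v. min (k v) (k' v)) * Z2 (\<lambda>v. max (k v) (k' v))"
    proof (cases "(\<forall>v\<in>B. k v = 1) \<and> (\<forall>v\<in>bdry E D'. k' v = 1)")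
      case False
      then have "Z1 k * Z2 k' = 0" by (auto simp: Z1_def Z2_def)
      then show ?thesis using nonneg by (simp only: mult_nonneg_nonneg)
    next
      case True
      have BV: "v \<in> V" if "v \<in> B" for v using that sub(1) by (auto simp: B_def bdry_def)
      \<comment> \<open>The constraints pass to meet and join: positive levels are at least
        \<open>1\<close>, so the meet is \<open>1\<close> wherever \<open>k = 1\<close>; on the
        boundary of \<open>D'\<close> both \<open>k\<close> and \<open>k'\<close> are
        \<open>1\<close>.\<close>
      have "min (k v) (k' v) = 1" if "v \<in> B" for v
        using True that PiE_mem[OF k' BV[OF that]] by auto
      moreover have "max (k v) (k' v) = 1" if "v \<in> bdry E D'" for v
        using True that bdry'[OF that] by simp
      moreover have "k v = 1" if "v \<in> V" "\<exists>e\<in>F' - F. v \<in> e" for v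
        using new_edges[OF that] True by blast
      note ising_Z_coeff_lattice[OF V(1,2) sub(2) V(3) k k' this]
      ultimately show ?thesis using True by (simp add: Z1_def Z2_def)
    qed
    moreover have "(real_of_int (k x))\<^sup>2 \<le> (real_of_int (max (k x) (k' x)))\<^sup>2"
      using PiE_mem[OF k, of x] x sub(1) by (intro power_mono) auto
    ultimately have "(Z1 k * Z2 k') * (real_of_int (k x))\<^sup>2 \<le>
      (Z1 (\<lambda>v. min (k v) (k' v)) * Z2 (\<lambda>v. max (k v) (k' v))) * (real_of_int (max (k x) (k' x)))\<^sup>2"
      using nonneg by (intro mult_mono[of "Z1 k * Z2 k'"]) auto
    then show "Z1 k * (real_of_int (k x))\<^sup>2 * Z2 k' \<le> Z1 (\<lambda>v. min (k v) (k' v)) *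
      (Z2 (\<lambda>v. max (k v) (k' v)) * (real_of_int (max (k x) (k' x)))\<^sup>2)"
      by (simp only: mult_ac)
  qed
  then have "N * (num D * den D') \<le> N * (den D * num D')"
    unfolding num1 den1 num2 den2 by (simp only: mult_ac)
  then have "num D * den D' \<le> den D * num D'" by (simp add: N_def)
  moreover have "0 < den D" "0 < den D'"
    unfolding den_def using partition_function_pos D D' by auto
  ultimately have "num D / den D \<le> num D' / den D'" by (simp add: field_simps)
  then show ?thesis by (simp add: Eh2_def num_def den_def)
qed

section \<open>The localisation dichotomy\<close>

text \<open>Pointwise, \<open>b^2 \<le> 2 * a^2 + 2 * (a - b)^2\<close>, the difference of the two
  sides being \<open>(2 * a - b)^2\<close>. Adjacent heights have
  \<open>(a - b)^2 \<le> 4\<close>.\<close>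

lemma Eh2_adjacent:
  assumes D: "fin_conn_subgraph E D" and xy: "{x, y} \<in> snd D"
  shows "Eh2 E c D y \<le> 2 * Eh2 E c D x + 8"
proof -
  let ?Z = "\<Sum>h\<in>height_funs E D. hweight c D h"
  have pointwise: "(real_of_int (h y))\<^sup>2 \<le> 2 * (real_of_int (h x))\<^sup>2 + 8" if "h \<in> height_funs E D" for h
  proof -
    have "\<bar>h x - h y\<bar> \<le> 2" using that xy by (simp add: height_funs_def)
    then have "\<bar>real_of_int (h x) - real_of_int (h y)\<bar> \<le> 2" by linarith
    then have "(real_of_int (h x) - real_of_int (h y))\<^sup>2 \<le> 2\<^sup>2"
      using abs_le_square_iff[of "real_of_int (h x) - real_of_int (h y)" 2] by simp
    moreover have "0 \<le> (2 * real_of_int (h x) - real_of_int (h y))\<^sup>2" by simp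
    ultimately show ?thesis by (simp add: power2_eq_square algebra_simps)
  qed
  have "(\<Sum>h\<in>height_funs E D. hweight c D h * (real_of_int (h y))\<^sup>2)
      \<le> (\<Sum>h\<in>height_funs E D. hweight c D h * (2 * (real_of_int (h x))\<^sup>2 + 8))"
    using hweight_pos[OF D] by (intro sum_mono mult_left_mono pointwise) (auto intro: less_imp_le)
  also have "\<dots> = 2 * (\<Sum>h\<in>height_funs E D. hweight c D h * (real_of_int (h x))\<^sup>2) + 8 * ?Z"
    by (simp add: algebra_simps sum.distrib sum_distrib_left)
  finally show ?thesis
    using partition_function_pos[OF D] by (simp add: Eh2_def field_simps)
qed

text \<open>Quantifying over all finite connected subgraphs makes the alternative independent of any
  exhaustion.\<close>

definition bounded_at :: "'v \<Rightarrow> bool" where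
  "bounded_at x \<longleftrightarrow> (\<exists>C. \<forall>D. fin_conn_subgraph E D \<and> x \<in> fst D \<longrightarrow> Eh2 E c D x \<le> C)"

text \<open>Comparing second moments at adjacent vertices needs a subgraph that contains their edge.
  Connectedness persists because every vertex still reaches \<open>y\<close>.\<close>

lemma fin_conn_subgraph_add_edge:
  assumes D: "fin_conn_subgraph E D" and y: "y \<in> fst D" and xy: "E x y"
  shows "fin_conn_subgraph E (insert x (fst D), insert {x, y} (snd D))"
proof -
  define R where "R = (\<lambda>a b. {a, b} \<in> insert {x, y} (snd D))"
  have R_sym: "R\<^sup>*\<^sup>* b a" if "R\<^sup>*\<^sup>* a b" for a b
  proof -
    have "symp R" by (auto simp: R_def symp_def insert_commute)
    then show ?thesis using that by (metis symp_rtranclp sympD)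
  qed
  have old: "R\<^sup>*\<^sup>* a b" if "a \<in> fst D" "b \<in> fst D" for a b
  proof -
    have "(\<lambda>a b. {a, b} \<in> snd D)\<^sup>*\<^sup>* a b" using D that by (simp add: fin_conn_subgraph_def)
    then show ?thesis by (rule rtranclp_mono[THEN predicate2D, rotated]) (auto simp: R_def)
  qed
  have to_y: "R\<^sup>*\<^sup>* a y" if "a \<in> insert x (fst D)" for a
    using that old y by (auto simp: R_def)
  have "R\<^sup>*\<^sup>* a b" if "a \<in> insert x (fst D)" "b \<in> insert x (fst D)" for a b
    using to_y[OF that(1)] R_sym[OF to_y[OF that(2)]] by (rule rtranclp_trans)
  then show ?thesis
    using D y xy unfolding fin_conn_subgraph_def R_def Gedges_def by auto
qed

text \<open>Adding the edge to \<open>D\<close> does not decrease the second moment at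
  \<open>y\<close>, and in the enlarged subgraph it is controlled by the one at
  \<open>x\<close>.\<close>

lemma bounded_at_adjacent:
  assumes "bounded_at x" "E x y"
  shows "bounded_at y"
proof -
  obtain C where C: "\<And>D. fin_conn_subgraph E D \<Longrightarrow> x \<in> fst D \<Longrightarrow> Eh2 E c D x \<le> C"
    using assms(1) unfolding bounded_at_def by blast
  have "Eh2 E c D y \<le> 2 * C + 8" if D: "fin_conn_subgraph E D" "y \<in> fst D" for D
  proof -
    let ?D = "(insert x (fst D), insert {x, y} (snd D))"
    have D': "fin_conn_subgraph E ?D" using D assms(2) by (rule fin_conn_subgraph_add_edge)
    have "Eh2 E c D y \<le> Eh2 E c ?D y"
      using D D' by (intro Eh2_mono) (auto simp: subgraph_le_def)
    also have "\<dots> \<le> 2 * Eh2 E c ?D x + 8" using D' by (rule Eh2_adjacent) simp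
    also have "Eh2 E c ?D x \<le> C" using D' by (rule C) simp
    finally show ?thesis by simp
  qed
  then show ?thesis unfolding bounded_at_def by blast
qed

lemma bounded_at_everywhere:
  assumes "bounded_at x"
  shows "bounded_at y"
  using connected[of x y]
proof (induction rule: rtranclp_induct)
  case base
  show ?case by (rule assms)
next
  case (step v w)
  then show ?case using bounded_at_adjacent by blast
qed

section \<open>Limits along exhaustions\<close>

lemma exhaustion_mono:
  assumes "exhaustion E Ds" "m \<le> n"
  shows "subgraph_le (Ds m) (Ds n)"
  using assms(2)
proof (induction rule: dec_induct)
  case base
  show ?case by (simp add: subgraph_le_def)
next
  case (step n)
  have "subgraph_le (Ds n) (Ds (Suc n))" using assms(1) by (simp add: exhaustion_def)
  then show ?case using step.IH by (auto simp: subgraph_le_def)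
qed

text \<open>Each of the finitely many vertices and edges of \<open>D\<close> enters the exhaustion
  at some index and stays.\<close>

lemma exhaustion_absorbs:
  assumes Ds: "exhaustion E Ds" and D: "fin_conn_subgraph E D"
  shows "\<forall>\<^sub>F n in sequentially. subgraph_le D (Ds n)"
proof -
  have "\<forall>\<^sub>F n in sequentially. v \<in> fst (Ds n)" for v
  proof -
    obtain m where "v \<in> fst (Ds m)" using Ds unfolding exhaustion_def by blast
    then show ?thesis
      using exhaustion_mono[OF Ds, of m] by (auto simp: eventually_sequentially subgraph_le_def)
  qed
  then have "\<forall>\<^sub>F n in sequentially. \<forall>v\<in>fst D. v \<in> fst (Ds n)"
    using subgraph_finite(1)[OF D] by (simp add: eventually_ball_finite_distrib)
  moreover have "\<forall>\<^sub>F n in sequentially. e \<in> snd (Ds n)" if "e \<in> snd D" for e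
  proof -
    have "e \<in> Gedges E" using D that by (auto simp: fin_conn_subgraph_def)
    then obtain m where "e \<in> snd (Ds m)" using Ds unfolding exhaustion_def by blast
    then show ?thesis
      using exhaustion_mono[OF Ds, of m] by (auto simp: eventually_sequentially subgraph_le_def)
  qed
  then have "\<forall>\<^sub>F n in sequentially. \<forall>e\<in>snd D. e \<in> snd (Ds n)"
    using subgraph_finite(2)[OF D] by (simp add: eventually_ball_finite_distrib)
  ultimately show ?thesis
    by eventually_elim (auto simp: subgraph_le_def)
qed

lemma exhaustion_eventually_mem:
  assumes "exhaustion E Ds"
  obtains N where "\<And>n. N \<le> n \<Longrightarrow> x \<in> fst (Ds n)"
proof -
  obtain N where "x \<in> fst (Ds N)" using assms unfolding exhaustion_def by blast
  then show thesis using that[of N] exhaustion_mono[OF assms, of N] by (auto simp: subgraph_le_def)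
qed

lemma convergent_if_bounded_at:
  assumes Ds: "exhaustion E Ds" and "bounded_at x"
  shows "convergent (\<lambda>n. Eh2 E c (Ds n) x)"
proof -
  obtain C where C: "\<And>D. fin_conn_subgraph E D \<Longrightarrow> x \<in> fst D \<Longrightarrow> Eh2 E c D x \<le> C"
    using assms(2) unfolding bounded_at_def by blast
  obtain N where N: "\<And>n. N \<le> n \<Longrightarrow> x \<in> fst (Ds n)"
    using exhaustion_eventually_mem[OF Ds] by blast
  have fin: "fin_conn_subgraph E (Ds n)" for n using Ds by (simp add: exhaustion_def)
  \<comment> \<open>Monotonicity at \<open>x\<close> applies only once \<open>x\<close> has entered
    the exhaustion, hence the shift by \<open>N\<close>.\<close>
  have inc: "incseq (\<lambda>n. Eh2 E c (Ds (n + N)) x)"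
    using fin N exhaustion_mono[OF Ds] by (intro monoI Eh2_mono) auto
  have "\<forall>n. Eh2 E c (Ds (n + N)) x \<le> C" using C[OF fin N] by simp
  from incseq_convergent[OF inc this] obtain L where "(\<lambda>n. Eh2 E c (Ds (n + N)) x) \<longlonglongrightarrow> L" .
  then have "(\<lambda>n. Eh2 E c (Ds n) x) \<longlonglongrightarrow> L" by (rule LIMSEQ_offset)
  then show ?thesis by (rule convergentI)
qed

text \<open>One subgraph with second moment above \<open>C\<close> suffices: the exhaustion
  eventually contains it, and by monotonicity the later values exceed \<open>C\<close> too.\<close>

lemma filterlim_if_not_bounded_at:
  assumes Ds: "exhaustion E Ds" and "\<not> bounded_at x"
  shows "filterlim (\<lambda>n. Eh2 E c (Ds n) x) at_top sequentially"
  unfolding filterlim_at_top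
proof
  fix C
  obtain D where D: "fin_conn_subgraph E D" "x \<in> fst D" "C < Eh2 E c D x"
    using assms(2) unfolding bounded_at_def not_le[symmetric] by blast
  have fin: "fin_conn_subgraph E (Ds n)" for n using Ds by (simp add: exhaustion_def)
  show "\<forall>\<^sub>F n in sequentially. C \<le> Eh2 E c (Ds n) x"
    using exhaustion_absorbs[OF Ds D(1)]
  proof eventually_elim
    case (elim n)
    then show ?case using Eh2_mono[OF D(1) fin elim D(2)] D(3) by simp
  qed
qed

end

theorem theorem5p1:
  fixes E :: "'v \<Rightarrow> 'v \<Rightarrow> bool" and c :: "'v set \<Rightarrow> real"
  assumes countable: "countable (UNIV :: 'v set)"
    and infinite: "infinite (UNIV :: 'v set)"
    and sym: "\<And>v w. E v w \<Longrightarrow> E w v"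
    and irrefl: "\<And>v. \<not> E v v"
    and locfin: "\<And>v. finite {w. E v w}"
    and connected: "\<And>v w. E\<^sup>*\<^sup>* v w"
    and weights: "\<And>e. e \<in> Gedges E \<Longrightarrow> c e \<ge> 1"
  shows "(\<forall>x D D'. fin_conn_subgraph E D \<and> fin_conn_subgraph E D' \<and> subgraph_le D D' \<and> x \<in> fst D
             \<longrightarrow> Eh2 E c D x \<le> Eh2 E c D' x)
       \<and> ((\<forall>x Ds. exhaustion E Ds \<longrightarrow> convergent (\<lambda>n. Eh2 E c (Ds n) x))
          \<or> (\<forall>x Ds. exhaustion E Ds \<longrightarrow> filterlim (\<lambda>n. Eh2 E c (Ds n) x) at_top sequentially))"
proof -
  interpret height_model E c
    by (unfold_locales; fact infinite sym irrefl connected weights)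
  show ?thesis
  proof (intro conjI)
    show "\<forall>x D D'. fin_conn_subgraph E D \<and> fin_conn_subgraph E D' \<and> subgraph_le D D' \<and> x \<in> fst D
             \<longrightarrow> Eh2 E c D x \<le> Eh2 E c D' x"
      using Eh2_mono by blast
    show "(\<forall>x Ds. exhaustion E Ds \<longrightarrow> convergent (\<lambda>n. Eh2 E c (Ds n) x))
          \<or> (\<forall>x Ds. exhaustion E Ds \<longrightarrow> filterlim (\<lambda>n. Eh2 E c (Ds n) x) at_top sequentially)"
    \<comment> \<open>Boundedness at one vertex spreads to all, so the same alternative holds for
      all vertices and all exhaustions.\<close>
    proof (cases "\<exists>x. bounded_at x")
      case True
      then show ?thesis using convergent_if_bounded_at bounded_at_everywhere by blast
    next
      case False
      then show ?thesis using filterlim_if_not_bounded_at by blast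
    qed
  qed
qed

end
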